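(* The following identities hold. (1) We have $$\underline{F}_{\mathrm{eu}}^{\mathrm{od}}(q) = \frac{(-q^2;q^2)_\infty}{(q^2;q^2)_\infty}\,\phi(q).$$ (2) We have $$\underline{F}_{\mathrm{od}}^{\mathrm{eu}}(q) = \frac{(-q^2;q^2)_\infty}{(q^2;q^2)_\infty} - 2q\,(-q;q^2)_\infty\sum_{n\ge 0}\frac{q^n}{(-q^2;q^2)_{n+1}} + 4q\,\frac{(-q^2;q^2)_\infty}{(q^2;q^2)_\infty}\sum_{n\ge 0}\frac{(-1)^n q^{n^2+2n}}{(1+q^{2n+2})(q;q^2)_{n+1}}.$$ (3) We have $$\underline{F}_{\mathrm{ed}}^{\mathrm{ou}}(q) = -2q\,(-q^2;q^2)_\infty\sum_{n\ge 0}\frac{q^n}{(-q^2;q^2)_{n+1}} + \frac{(-q;q^2)_\infty}{(q;q^2)_\infty}\sum_{n\ge 0}\frac{(-1)^n(-q;q^2)_{n+1}\,q^{n^2+n}}{(-q^2,q;q^2)_{n+1}}.$$ (4) We have $$\underline{F}_{\mathrm{ou}}^{\mathrm{ed}}(q) = (-q^2;q^2)_\infty\left(1+2q\sum_{n\ge 0}\frac{(-q;q^2)_n}{(q,-q^2;q^2)_n}\,q^{2n}\right).$$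
   Context: **$q$-Pochhammer symbols.** For $n\in\mathbb{N}_0\cup\{\infty\}$ and $m\in\mathbb{N}$, $(a;q)_n := \prod_{k=0}^{n-1}(1-aq^k)$ and $(a_1,\dots,a_m;q)_n := \prod_{k=1}^m (a_k;q)_n$; with $q$ replaced by $q^2$ this gives $(a;q^2)_n=\prod_{k=0}^{n-1}(1-aq^{2k})$, etc. **Mock theta function.** $\phi(q) := \sum_{n\ge 0}\frac{q^{n^2}}{(-q^2;q^2)_n}$ (a third order mock theta function). **Overpartitions.** A partition of $n$ is a non-increasing sequence of positive integers (its parts) with sum $n$. An overpartition of $n$ is a partition of $n$ in which the first instance of each part may possibly be overlined. An overpartition has parts separated by parity if each even part is larger than each odd part, or if each odd part is larger than each even part; overpartitions into only odd parts or only even parts are permitted. **The modified counting functions.** Let $\{\mathrm{x},\mathrm{z}\}=\{\mathrm{e},\mathrm{o}\}$ and $\mathrm{y},\mathrm{w}\in\{\mathrm{u},\mathrm{d}\}$, where $\mathrm{e}$ = even, $\mathrm{o}$ = odd, $\mathrm{u}$ = unrestricted, $\mathrm{d}$ = distinct. Then $\underline{p}_{\mathrm{xy}}^{\mathrm{zw}}(n)$ is the number of overpartitions of $n$ with parts separated by parity such that every part of parity $\mathrm{z}$ (upper index) is larger than every part of parity $\mathrm{x}$ (lower index), where the parts of parity $\mathrm{x}$ must be distinct if $\mathrm{y}=\mathrm{d}$ and are unrestricted if $\mathrm{y}=\mathrm{u}$, the parts of parity $\mathrm{z}$ must be distinct if $\mathrm{w}=\mathrm{d}$ and are unrestricted if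 $\mathrm{w}=\mathrm{u}$, and, in addition, any parts required to be distinct cannot be overlined. For example, $\underline{p}_{\mathrm{od}}^{\mathrm{eu}}(3)=3$, counting $3,\ 2+1,\ \overline{2}+1$. The generating functions are $\underline{F}_{\mathrm{xy}}^{\mathrm{zw}}(q) := \sum_{n\ge 0}\underline{p}_{\mathrm{xy}}^{\mathrm{zw}}(n)\,q^n$.
   Formalization: (2)-(4) fail as printed (coefficients of q, q^2, q^2) and are corrected: in (2) -2q, 4q become -q, 2q; in (3) -2q becomes -q and the last term becomes half of (-q;q^2)_∞/(q;q^2)_∞ times (1 + the printed series); in (4) (q;q^2)_n in the denominator becomes (q;q^2)_{n+1}. *)

theory Defs
  imports "HOL-Analysis.Analysis"
begin

definition qpoch :: "complex \<Rightarrow> complex \<Rightarrow> nat \<Rightarrow> complex"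
  where "qpoch a q n = (\<Prod>k<n. 1 - a * q ^ k)"

definition qpoch_inf :: "complex \<Rightarrow> complex \<Rightarrow> complex"
  where "qpoch_inf a q = (\<Prod>k. 1 - a * q ^ k)"

(* (a_1,...,a_m; q)_n, with the list [a_1,...,a_m] as first argument *)
definition qpochs :: "complex list \<Rightarrow> complex \<Rightarrow> nat \<Rightarrow> complex"
  where "qpochs as q n = (\<Prod>a\<leftarrow>as. qpoch a q n)"

definition mock_phi :: "complex \<Rightarrow> complex"
  where "mock_phi q = (\<Sum>n. q ^ (n\<^sup>2) / qpoch (- (q\<^sup>2)) (q\<^sup>2) n)"

definition is_partition :: "nat list \<Rightarrow> nat \<Rightarrow> bool"
  where "is_partition ps n \<longleftrightarrow> sorted_wrt (\<ge>) ps \<and> (\<forall>k\<in>set ps. k > 0) \<and> sum_list ps = n"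

(* An entry (k, b) is a part of size k, overlined iff b holds.  Only the first
   occurrence of each part size may be overlined. *)
definition is_overpartition :: "(nat \<times> bool) list \<Rightarrow> nat \<Rightarrow> bool"
  where "is_overpartition xs n \<longleftrightarrow>
    is_partition (map fst xs) n \<and>
    (\<forall>i<length xs. snd (xs ! i) \<longrightarrow> (\<forall>j<i. fst (xs ! j) \<noteq> fst (xs ! i)))"

datatype part_parity = Ev | Od

datatype part_restriction = Unrestricted | Distinct

fun has_parity :: "part_parity \<Rightarrow> nat \<Rightarrow> bool"
  where
    "has_parity Ev k \<longleftrightarrow> even k"
  | "has_parity Od k \<longleftrightarrow> odd k"

definition parity_above :: "part_parity \<Rightarrow> part_parity \<Rightarrow> nat list \<Rightarrow> bool"
  where "parity_above z x ps \<longleftrightarrow>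
    (\<forall>k\<in>set ps. \<forall>l\<in>set ps. has_parity z k \<longrightarrow> has_parity x l \<longrightarrow> k > l)"

definition separated_by_parity :: "nat list \<Rightarrow> bool"
  where "separated_by_parity ps \<longleftrightarrow> parity_above Ev Od ps \<or> parity_above Od Ev ps"

(* Parts of the given parity that are required to be distinct also must not be overlined. *)
fun obeys :: "part_parity \<Rightarrow> part_restriction \<Rightarrow> (nat \<times> bool) list \<Rightarrow> bool"
  where
    "obeys x Unrestricted xs \<longleftrightarrow> True"
  | "obeys x Distinct xs \<longleftrightarrow>
       distinct (filter (has_parity x) (map fst xs)) \<and>
       (\<forall>(k, b)\<in>set xs. has_parity x k \<longrightarrow> \<not> b)"

(* x, y are the lower indices (smaller parts) and z, w the upper ones (larger parts);
   meant for x \<noteq> z. *)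
definition p_sep ::
    "part_parity \<Rightarrow> part_restriction \<Rightarrow> part_parity \<Rightarrow> part_restriction \<Rightarrow> nat \<Rightarrow> nat"
  where "p_sep x y z w n =
    card {xs. is_overpartition xs n \<and> separated_by_parity (map fst xs) \<and>
              parity_above z x (map fst xs) \<and> obeys x y xs \<and> obeys z w xs}"

definition F_sep ::
    "part_parity \<Rightarrow> part_restriction \<Rightarrow> part_parity \<Rightarrow> part_restriction \<Rightarrow> complex \<Rightarrow> complex"
  where "F_sep x y z w q = (\<Sum>n. of_nat (p_sep x y z w n) * q ^ n)"

end

theory Submission
  imports Defs
begin

text \<open>
  Split the overpartitions counted by a given function by the largest part \<open>m\<close> of the lower parity \<open>x\<close>
  (\<open>m = 0\<close> if there is none).  Once this pivot is fixed the conditions on different part sizes are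
  independent: sizes of parity \<open>x\<close> below \<open>m\<close> and sizes of parity \<open>z\<close> above \<open>m\<close> are optional, the
  size \<open>m\<close> must occur if \<open>m > 0\<close>, and every other size is absent.  So each pivot contributes an infinite
  product, a quotient of \<open>q\<close>-Pochhammer symbols, and every generating function becomes a single
  \<open>q\<close>-series (\<open>F_sep_sums\<close>).

  With \<open>p = q\<^sup>2\<close>, the last of the four identities is this series as it stands.  In the first one the
  series has the terms \<open>(-1;p)\<^sub>n p\<^sup>n / ((p;p)\<^sub>n (-q;p)\<^sub>n)\<close>, and a limiting case of Heine's
  transformation (\<open>heine_transformation_limit\<close>) turns it into the mock theta function.  The other two
  both have the terms \<open>(yD;p)\<^sub>n (yt;p)\<^sub>n p\<^sup>n / (yp;p)\<^sub>n\<close> with \<open>D = -p\<close> and \<open>t = q\<close>, where \<open>y = -1\<close> in the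
  second and \<open>y = -1/q\<close> in the third identity; as \<open>D\<close> and \<open>t\<close> agree, so does the series
  \<open>\<Sum> t\<^sup>m / (D;p)\<^sub>m\<^sub>+\<^sub>1\<close> on the right.  Both are instances of one three-term relation
  (\<open>qpoch_three_term\<close>).  It holds because its left-hand side and, up to sign and a common infinite product, the
  last series \<open>T(y)\<close> on its right-hand side solve the same first-order \<open>p\<close>-difference equation in \<open>y\<close>;
  for \<open>T(y)\<close> this is a telescoping sum.  The difference of the two solutions is found by letting \<open>y\<close>
  tend to \<open>0\<close>, and \<open>T(0)\<close> is evaluated by the Rogers--Fine identity (\<open>rogers_fine_special\<close>).

  Each of these transformations is thus obtained by iterating a functional equation that multiplies a
  parameter by \<open>p\<close>, and by passing to the limit along the iteration.
\<close>

section \<open>Finite and infinite q-Pochhammer symbols\<close>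

lemma qpoch_0 [simp]: "qpoch a p 0 = 1"
  by (simp add: qpoch_def)

lemma qpoch_Suc: "qpoch a p (Suc n) = qpoch a p n * (1 - a * p ^ n)"
  by (simp add: qpoch_def)

lemma qpoch_add: "qpoch a p (m + n) = qpoch a p m * qpoch (a * p ^ m) p n"
  by (induction n) (simp_all add: qpoch_Suc power_add mult.assoc)

lemma qpoch_Suc_left: "qpoch a p (Suc n) = (1 - a) * qpoch (a * p) p n"
  using qpoch_add[of a p 1 n] by (simp add: qpoch_Suc)

lemma qpoch_nonzero:
  assumes "\<And>k. a * p ^ k \<noteq> 1"
  shows "qpoch a p n \<noteq> 0"
  unfolding qpoch_def using assms by simp

lemma abs_convergent_prod_qpoch:
  fixes a p :: complex
  assumes "norm p < 1"
  shows "abs_convergent_prod (\<lambda>k. 1 - a * p ^ k)"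
proof (rule summable_imp_abs_convergent_prod)
  have "summable (\<lambda>k. norm a * norm p ^ k)"
    using assms by (intro summable_mult summable_geometric) auto
  thus "summable (\<lambda>k. norm (1 - a * p ^ k - 1))"
    by (simp add: norm_mult norm_power)
qed

lemma qpoch_LIMSEQ:
  assumes "norm p < 1"
  shows "(\<lambda>n. qpoch a p n) \<longlonglongrightarrow> qpoch_inf a p"
proof -
  have "convergent_prod (\<lambda>k. 1 - a * p ^ k)"
    by (rule abs_convergent_prod_imp_convergent_prod[OF abs_convergent_prod_qpoch[OF assms]])
  hence "(\<lambda>n. \<Prod>k\<le>n. 1 - a * p ^ k) \<longlonglongrightarrow> qpoch_inf a p"
    unfolding qpoch_inf_def by (rule convergent_prod_LIMSEQ)
  hence "(\<lambda>n. qpoch a p (Suc n)) \<longlonglongrightarrow> qpoch_inf a p"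
    by (simp add: qpoch_def lessThan_Suc_atMost)
  thus ?thesis
    by (rule LIMSEQ_imp_Suc)
qed

lemma qpoch_inf_nonzero:
  assumes "norm p < 1" "\<And>k. a * p ^ k \<noteq> 1"
  shows "qpoch_inf a p \<noteq> 0"
  unfolding qpoch_inf_def
  by (rule prodinf_nonzero)
     (use assms abs_convergent_prod_imp_convergent_prod[OF abs_convergent_prod_qpoch] in auto)

lemma qpoch_bounded:
  assumes "norm p < 1"
  obtains K where "K > 0" "\<And>n. norm (qpoch a p n) \<le> K"
  using Bseq_def[of "qpoch a p"] convergent_imp_Bseq[OF convergentI[OF qpoch_LIMSEQ[OF assms, of a]]] by auto

text \<open>
  The reciprocals converge to a finite limit because the infinite product does not vanish.  These
  uniform bounds enter the majorants of the series below.
\<close>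

lemma inverse_qpoch_bounded:
  assumes "norm p < 1" "\<And>k. a * p ^ k \<noteq> 1"
  obtains K where "K > 0" "\<And>n. norm (1 / qpoch a p n) \<le> K"
proof -
  have "(\<lambda>n. 1 / qpoch a p n) \<longlonglongrightarrow> 1 / qpoch_inf a p"
    by (intro tendsto_intros qpoch_LIMSEQ qpoch_inf_nonzero assms)
  from convergent_imp_Bseq[OF convergentI[OF this]] that show thesis
    by (auto simp: Bseq_def)
qed

lemma mult_power_neq_1:
  fixes a p :: complex
  assumes "norm p < 1" "norm a < 1"
  shows "a * p ^ k \<noteq> 1"
proof -
  have "norm a * norm p ^ k < 1"
    using assms by (metis mult_le_cancel_left2 norm_ge_zero not_less order_le_less_trans power_le_one less_imp_le)
  thus ?thesis
    by (metis norm_mult norm_one norm_power less_irrefl)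
qed

text \<open>
  The ratio of consecutive terms is \<open>x r\<^sup>n\<close>, which tends to \<open>0\<close> however large \<open>x\<close> is.  The factor
  \<open>r\<close> raised to \<open>n choose 2\<close> is what keeps the series in \<open>qpoch_three_term\<close> convergent for every \<open>y\<close>.
\<close>

lemma summable_power_mult_power_choose_2:
  fixes x r :: real
  assumes "0 \<le> x" "0 \<le> r" "r < 1"
  shows "summable (\<lambda>n. x ^ n * r ^ (n choose 2))"
proof -
  have "(\<lambda>n. x * r ^ n) \<longlonglongrightarrow> x * 0"
    using assms by (intro tendsto_intros LIMSEQ_power_zero) auto
  hence "eventually (\<lambda>n. x * r ^ n < 1/2) sequentially"
    by (rule order_tendstoD(2)) auto
  then obtain N where N: "\<And>n. n \<ge> N \<Longrightarrow> x * r ^ n < 1/2"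
    by (auto simp: eventually_sequentially)
  show ?thesis
  proof (rule summable_ratio_test)
    show "(1/2::real) < 1" by simp
    fix n assume "n \<ge> N"
    have "norm (x ^ Suc n * r ^ (Suc n choose 2)) = (x * r ^ n) * norm (x ^ n * r ^ (n choose 2))"
      using assms by (simp add: numeral_2_eq_2 power_add mult_ac)
    also have "\<dots> \<le> 1/2 * norm (x ^ n * r ^ (n choose 2))"
      using N[OF \<open>n \<ge> N\<close>] by (intro mult_right_mono) auto
    finally show "norm (x ^ Suc n * r ^ (Suc n choose 2)) \<le> 1/2 * norm (x ^ n * r ^ (n choose 2))" .
  qed
qed

section \<open>A special case of the Rogers--Fine identity\<close>

lemma summable_power_over_qpoch:
  assumes "norm p < 1" "norm t < 1" "\<And>k. D * p ^ k \<noteq> 1"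
  shows "summable (\<lambda>m. t ^ m / qpoch D p (m + j))"
proof -
  obtain K where K: "K > 0" "\<And>n. norm (1 / qpoch D p n) \<le> K"
    using inverse_qpoch_bounded[of p D] assms by metis
  show ?thesis
  proof (rule summable_comparison_test')
    show "summable (\<lambda>m. norm t ^ m * K)"
      using assms by (intro summable_mult2 summable_geometric) auto
    show "norm (t ^ m / qpoch D p (m + j)) \<le> norm t ^ m * K" for m
      using mult_left_mono[OF K(2)[of "m + j"], of "norm t ^ m"]
      by (simp add: norm_divide norm_power)
  qed
qed

text \<open>
  Shifting \<open>t\<close> and shifting \<open>D\<close> by a factor \<open>p\<close> each gives a first-order relation for
  \<open>f(D, t) = \<Sum> t\<^sup>m / (D;p)\<^sub>m\<^sub>+\<^sub>1\<close>.  Composing the two moves both arguments at once, and the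
  product \<open>p D t\<close> that each step then contributes is what builds up the exponents \<open>n\<^sup>2\<close> of \<open>p\<close>.
\<close>

lemma fine_functional_equation:
  fixes D t p :: complex
  defines "f \<equiv> (\<lambda>D t. \<Sum>m. t ^ m / qpoch D p (m + 1))"
  assumes p: "norm p < 1" and t: "norm t < 1" and D: "\<And>k. D * p ^ k \<noteq> 1"
  shows "f D t = 1 / ((1 - D) * (1 - t))
           + p * D * t / ((1 - D) * (1 - t)) * f (D * p) (t * p)"
proof -
  have nz: "qpoch D p n \<noteq> 0" "1 - D * p ^ n \<noteq> 0" for n
    using qpoch_nonzero[of D p] D by auto
  have D': "D * p * p ^ k \<noteq> 1" for k
    using D[of "Suc k"] by (simp add: mult_ac)
  have tp: "norm (t * p) < 1"
    using p t mult_strict_mono'[of "norm t" 1 "norm p" 1] by (simp add: norm_mult)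
  have head: "(\<Sum>m. s ^ m / qpoch E p m) = 1 + s * f E s"
    if "norm s < 1" "\<And>k. E * p ^ k \<noteq> 1" for s E
  proof -
    have "(\<Sum>m. s ^ m / qpoch E p m) = 1 + (\<Sum>m. s ^ Suc m / qpoch E p (Suc m))"
      using suminf_split_head[OF summable_power_over_qpoch[of p s E 0]] p that by simp
    also have "(\<Sum>m. s ^ Suc m / qpoch E p (Suc m)) = s * f E s"
      unfolding f_def
      by (subst suminf_mult[symmetric]) (use summable_power_over_qpoch[of p s E 1] p that in simp_all)
    finally show ?thesis .
  qed
  \<comment> \<open>Since \<open>(1 - D p\<^sup>m) / (D;p)\<^sub>m\<^sub>+\<^sub>1 = 1 / (D;p)\<^sub>m\<close>, shifting \<open>t\<close> costs one factor \<open>D\<close>.\<close>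
  have shift_t: "(1 - t) * f D t = 1 + D * f D (t * p)"
  proof -
    have s1: "summable (\<lambda>m. t ^ m / qpoch D p (m + 1))" and s2: "summable (\<lambda>m. (t * p) ^ m / qpoch D p (m + 1))"
      using summable_power_over_qpoch[OF p _ D] t tp by blast+
    have "f D t - D * f D (t * p) = (\<Sum>m. t ^ m / qpoch D p (m + 1) - D * ((t * p) ^ m / qpoch D p (m + 1)))"
      unfolding f_def
      by (subst suminf_diff[symmetric, OF s1 summable_mult[OF s2]], subst suminf_mult[OF s2]) simp
    also have "\<dots> = (\<Sum>m. t ^ m / qpoch D p m)"
    proof (rule suminf_cong)
      fix m
      have "t ^ m / qpoch D p (m + 1) - D * ((t * p) ^ m / qpoch D p (m + 1))
              = t ^ m * (1 - D * p ^ m) / (qpoch D p m * (1 - D * p ^ m))"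
        by (simp add: qpoch_Suc power_mult_distrib algebra_simps flip: diff_divide_distrib)
      thus "t ^ m / qpoch D p (m + 1) - D * ((t * p) ^ m / qpoch D p (m + 1)) = t ^ m / qpoch D p m"
        using nz(2)[of m] by simp
    qed
    also have "\<dots> = 1 + t * f D t"
      using head t D by blast
    finally show ?thesis by (simp add: algebra_simps)
  qed
  \<comment> \<open>Dually, \<open>(1 - D) / (D;p)\<^sub>m\<^sub>+\<^sub>1 = 1 / (D p;p)\<^sub>m\<close>, so shifting \<open>D\<close> costs one factor \<open>t\<close>.\<close>
  have shift_D: "(1 - D) * f D (t * p) = 1 + t * p * f (D * p) (t * p)"
  proof -
    have s2: "summable (\<lambda>m. (t * p) ^ m / qpoch D p (m + 1))"
      using summable_power_over_qpoch[OF p tp D] .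
    have "(1 - D) * f D (t * p) = (\<Sum>m. (1 - D) * ((t * p) ^ m / qpoch D p (m + 1)))"
      unfolding f_def by (rule suminf_mult[OF s2, symmetric])
    also have "\<dots> = (\<Sum>m. (t * p) ^ m / qpoch (D * p) p m)"
      using nz(2)[of 0] by (intro suminf_cong) (simp add: qpoch_Suc_left)
    also have "\<dots> = 1 + t * p * f (D * p) (t * p)"
      using head tp D' by blast
    finally show ?thesis .
  qed
  have t1: "1 - t \<noteq> 0" using t by auto
  have D1: "1 - D \<noteq> 0" using nz(2)[of 0] by simp
  have e1: "f D t = (1 + D * f D (t * p)) / (1 - t)"
    using shift_t t1 by (simp add: field_simps)
  have "1 + D * f D (t * p) = (1 + D * (t * p * f (D * p) (t * p))) / (1 - D)"
  proof -
    have "(1 + D * f D (t * p)) * (1 - D) = (1 - D) + D * ((1 - D) * f D (t * p))"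
      by (simp add: algebra_simps)
    also have "\<dots> = 1 + D * (t * p * f (D * p) (t * p))"
      unfolding shift_D by (simp add: algebra_simps)
    finally show ?thesis
      using D1 by (simp add: nonzero_eq_divide_eq)
  qed
  thus ?thesis
    unfolding e1 by (simp add: add_divide_distrib mult_ac)
qed

text \<open>
  Iterating \<open>fine_functional_equation\<close> \<open>N\<close> times produces the first \<open>N\<close> terms and a remainder
  \<open>R N * f N\<close>.  The factor \<open>f N\<close> stays bounded because \<open>1 / (Dp\<^sup>N;p)\<^sub>m\<close> equals \<open>(D;p)\<^sub>N / (D;p)\<^sub>N\<^sub>+\<^sub>m\<close>, and
  \<open>R N\<close> tends to \<open>0\<close> because of the factor \<open>p\<close> raised to \<open>N\<^sup>2\<close>.  This is the Rogers--Fine identity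
  with vanishing numerator parameter.
\<close>

lemma rogers_fine_special:
  fixes D t p :: complex
  assumes p: "norm p < 1" and t: "norm t < 1" and D: "\<And>k. D * p ^ k \<noteq> 1"
  shows "(\<lambda>n. p ^ (n\<^sup>2) * (D * t) ^ n / (qpoch D p (n + 1) * qpoch t p (n + 1)))
           sums (\<Sum>m. t ^ m / qpoch D p (m + 1))"
proof -
  define f where "f = (\<lambda>N. \<Sum>m. (t * p ^ N) ^ m / qpoch (D * p ^ N) p (m + 1))"
  define u where "u = (\<lambda>n. p ^ (n\<^sup>2) * (D * t) ^ n / (qpoch D p (n + 1) * qpoch t p (n + 1)))"
  define R where "R = (\<lambda>n. p ^ (n\<^sup>2) * (D * t) ^ n / (qpoch D p n * qpoch t p n))"
  have T: "t * p ^ k \<noteq> 1" for k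
    using mult_power_neq_1[OF p t] .
  have nz: "qpoch D p n \<noteq> 0" "1 - D * p ^ n \<noteq> 0" "qpoch t p n \<noteq> 0" "1 - t * p ^ n \<noteq> 0" for n
    using qpoch_nonzero[of D p] qpoch_nonzero[of t p] D T by auto
  have DN: "D * p ^ N * p ^ k \<noteq> 1" for N k
    using D[of "N + k"] by (simp add: power_add mult_ac)
  have tN_le: "norm (t * p ^ N) \<le> norm t" for N
    using p by (simp add: norm_mult norm_power mult_left_le power_le_one)
  have tN: "norm (t * p ^ N) < 1" for N
    using tN_le[of N] t by simp
  have partial: "f 0 = (\<Sum>n<N. u n) + R N * f N" for N
  proof (induction N)
    case (Suc N)
    have "f N = 1 / ((1 - D * p ^ N) * (1 - t * p ^ N))
           + p * (D * p ^ N) * (t * p ^ N) / ((1 - D * p ^ N) * (1 - t * p ^ N)) * f (Suc N)"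
      using fine_functional_equation[OF p tN DN, of N N] by (simp add: f_def mult_ac)
    moreover have "u N = R N / ((1 - D * p ^ N) * (1 - t * p ^ N))"
      using nz by (simp add: u_def R_def qpoch_Suc field_simps)
    moreover have "R (Suc N) = R N * (p * (D * p ^ N) * (t * p ^ N) / ((1 - D * p ^ N) * (1 - t * p ^ N)))"
    proof -
      have "p ^ ((Suc N)\<^sup>2) = p ^ (N\<^sup>2) * (p * p ^ N * p ^ N)"
        by (simp add: power2_eq_square power_add)
      thus ?thesis
        unfolding R_def by (simp add: qpoch_Suc mult_ac)
    qed
    ultimately have "R N * f N = u N + R (Suc N) * f (Suc N)"
      by (simp add: algebra_simps)
    with Suc show ?case by simp
  qed (simp add: R_def)
  obtain K1 where K1: "K1 > 0" "\<And>n. norm (qpoch D p n) \<le> K1"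
    using qpoch_bounded[OF p] by metis
  obtain K2 where K2: "K2 > 0" "\<And>n. norm (1 / qpoch D p n) \<le> K2"
    using inverse_qpoch_bounded[OF p D] by metis
  obtain K3 where K3: "K3 > 0" "\<And>n. norm (1 / qpoch t p n) \<le> K3"
    using inverse_qpoch_bounded[OF p T] by metis
  have f_bound: "norm (f N) \<le> (\<Sum>m. norm t ^ m * (K1 * K2))" for N
    unfolding f_def
  proof (rule norm_suminf_le)
    show "summable (\<lambda>m. norm t ^ m * (K1 * K2))"
      using t by (intro summable_mult2 summable_geometric) auto
    fix m
    have "1 / qpoch (D * p ^ N) p (m + 1) = qpoch D p N * (1 / qpoch D p (N + (m + 1)))"
      using nz(1) by (simp add: qpoch_add field_simps del: add_Suc_right)
    hence "norm (1 / qpoch (D * p ^ N) p (m + 1)) \<le> K1 * K2"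
      using mult_mono[OF K1(2)[of N] K2(2)[of "N + (m + 1)"]] K1(1) by (simp only: norm_mult) simp
    moreover have "norm ((t * p ^ N) ^ m) \<le> norm t ^ m"
      using power_mono[OF tN_le[of N], of m] by (simp add: norm_power)
    ultimately have "norm ((t * p ^ N) ^ m) * norm (1 / qpoch (D * p ^ N) p (m + 1)) \<le> norm t ^ m * (K1 * K2)"
      by (intro mult_mono) auto
    thus "norm ((t * p ^ N) ^ m / qpoch (D * p ^ N) p (m + 1)) \<le> norm t ^ m * (K1 * K2)"
      by (simp add: norm_divide)
  qed
  have R_lim: "R \<longlonglongrightarrow> 0"
  proof (rule Lim_null_comparison)
    have "(\<lambda>n. norm (D * t) ^ n * norm p ^ (n choose 2)) \<longlonglongrightarrow> 0"
      by (rule summable_LIMSEQ_zero[OF summable_power_mult_power_choose_2]) (use p in auto)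
    from tendsto_mult_right[OF this, of "K2 * K3"]
    show "(\<lambda>n. norm (D * t) ^ n * norm p ^ (n choose 2) * (K2 * K3)) \<longlonglongrightarrow> 0"
      by simp
    show "\<forall>\<^sub>F n in sequentially. norm (R n) \<le> norm (D * t) ^ n * norm p ^ (n choose 2) * (K2 * K3)"
    proof (rule always_eventually, rule allI)
      fix n
      have "n choose 2 \<le> n\<^sup>2"
        by (cases n) (auto simp: choose_two power2_eq_square)
      hence a: "norm p ^ (n\<^sup>2) \<le> norm p ^ (n choose 2)"
        using p by (intro power_decreasing) auto
      have b: "norm (1 / qpoch D p n) * norm (1 / qpoch t p n) \<le> K2 * K3"
        using K2(1) by (intro mult_mono K2(2) K3(2)) simp_all
      have "norm (R n) = norm (D * t) ^ n * norm p ^ (n\<^sup>2) * (norm (1 / qpoch D p n) * norm (1 / qpoch t p n))"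
        by (simp add: R_def norm_mult norm_divide norm_power)
      also have "\<dots> \<le> norm (D * t) ^ n * norm p ^ (n choose 2) * (K2 * K3)"
        by (intro mult_mono[OF mult_left_mono[OF a] b]) auto
      finally show "norm (R n) \<le> norm (D * t) ^ n * norm p ^ (n choose 2) * (K2 * K3)" .
    qed
  qed
  have "(\<lambda>N. R N * f N) \<longlonglongrightarrow> 0"
  proof (rule Lim_null_comparison)
    show "\<forall>\<^sub>F N in sequentially. norm (R N * f N) \<le> norm (R N) * (\<Sum>m. norm t ^ m * (K1 * K2))"
      using f_bound by (intro always_eventually allI) (simp add: norm_mult mult_left_mono)
    show "(\<lambda>N. norm (R N) * (\<Sum>m. norm t ^ m * (K1 * K2))) \<longlonglongrightarrow> 0"
      using R_lim by (intro tendsto_mult_left_zero tendsto_norm_zero)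
  qed
  hence "(\<lambda>N. f 0 - R N * f N) \<longlonglongrightarrow> f 0 - 0"
    by (intro tendsto_diff tendsto_const)
  moreover have "f 0 - R N * f N = (\<Sum>n<N. u n)" for N
    using partial[of N] by simp
  ultimately have "u sums f 0"
    by (simp add: sums_def)
  thus ?thesis
    by (simp add: u_def f_def)
qed

section \<open>A three-term relation\<close>

text \<open>
  Write \<open>G\<^sub>n = (yD;p)\<^sub>n (yt;p)\<^sub>n / (yp;p)\<^sub>n\<close> and let \<open>T(y)\<close> be the last series in the statement.
  Then \<open>T(z) - (1 - zD) (1 - zt) / (1 - zp) * T(zp) = -z\<close>, so iterating from \<open>z = y\<close> gives
  \<open>y * (G\<^sub>0 + G\<^sub>1 p + \<dots> + G\<^sub>N\<^sub>-\<^sub>1 p\<^sup>N\<^sup>-\<^sup>1) = G\<^sub>N * T(yp\<^sup>N) - T(y)\<close>.  As \<open>N\<close> grows, \<open>T(yp\<^sup>N)\<close> tends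
  to \<open>T(0)\<close>, which the Rogers--Fine identity evaluates.
\<close>

lemma qpoch_three_term:
  fixes D t p y :: complex
  assumes p: "norm p < 1" and t: "norm t < 1" and D: "\<And>k. D * p ^ k \<noteq> 1"
    and yp: "\<And>k. y * p * p ^ k \<noteq> 1" and y: "y \<noteq> 0"
  shows "summable (\<lambda>n. (\<Prod>k<n + 1. p ^ k - y) * (t * D) ^ n * p ^ (n choose 2)
                / (qpoch D p (n + 1) * qpoch t p (n + 1)))" (is ?summable)
    and "(\<lambda>n. qpoch (y * D) p n * qpoch (y * t) p n / qpoch (y * p) p n * p ^ n) sums
     ((qpoch_inf (y * D) p * qpoch_inf (y * t) p / qpoch_inf (y * p) p
           * (\<Sum>m. t ^ m / qpoch D p (m + 1))
       - (\<Sum>n. (\<Prod>k<n + 1. p ^ k - y) * (t * D) ^ n * p ^ (n choose 2)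
                / (qpoch D p (n + 1) * qpoch t p (n + 1)))) / y)" (is ?sums)
proof -
  define G where "G = (\<lambda>n. qpoch (y * D) p n * qpoch (y * t) p n / qpoch (y * p) p n)"
  define P where "P = (\<lambda>z n. \<Prod>k<n. p ^ k - z)"
  define c where "c = (\<lambda>n. (t * D) ^ n * p ^ (n choose 2) / (qpoch D p (n + 1) * qpoch t p (n + 1)))"
  define c' where "c' = (\<lambda>n. (t * D) ^ n * p ^ (n choose 2) / (qpoch D p n * qpoch t p n))"
  define T where "T = (\<lambda>z. \<Sum>n. P z (n + 1) * c n)"
  have T1: "t * p ^ k \<noteq> 1" for k
    using mult_power_neq_1[OF p t] .
  have nz: "qpoch D p n \<noteq> 0" "1 - D * p ^ n \<noteq> 0" "qpoch t p n \<noteq> 0" "1 - t * p ^ n \<noteq> 0"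
           "qpoch (y * p) p n \<noteq> 0" "1 - y * p * p ^ n \<noteq> 0" for n
    using qpoch_nonzero[of D p] qpoch_nonzero[of t p] qpoch_nonzero[of "y * p" p] D T1 yp by auto
  obtain K2 where K2: "K2 > 0" "\<And>n. norm (1 / qpoch D p n) \<le> K2"
    using inverse_qpoch_bounded[OF p D] by metis
  obtain K3 where K3: "K3 > 0" "\<And>n. norm (1 / qpoch t p n) \<le> K3"
    using inverse_qpoch_bounded[OF p T1] by metis
  define M where "M = (\<lambda>r n. (r * norm (t * D)) ^ n * norm p ^ (n choose 2) * (K2 * K3))"
  have M_summable: "summable (M r)" if "r \<ge> 0" for r
    unfolding M_def by (intro summable_mult2 summable_power_mult_power_choose_2) (use that p in auto)
  have P_bound: "norm (P z n) \<le> r ^ n" if "1 + norm z \<le> r" for z r n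
  proof -
    have "norm (P z n) \<le> (\<Prod>k<n. r)"
      unfolding P_def prod_norm[symmetric]
    proof (rule prod_mono, safe)
      fix k
      have "norm (p ^ k - z) \<le> norm (p ^ k) + norm z"
        by (rule norm_triangle_ineq4)
      also have "norm (p ^ k) \<le> 1"
        using p by (simp add: norm_power power_le_one)
      finally show "norm (p ^ k - z) \<le> r"
        using that by linarith
    qed simp
    thus ?thesis by simp
  qed
  have c_bound: "norm (c n) \<le> norm (t * D) ^ n * norm p ^ (n choose 2) * (K2 * K3)" for n
  proof -
    have b: "norm (1 / qpoch D p (n + 1)) * norm (1 / qpoch t p (n + 1)) \<le> K2 * K3"
      using K2(1) by (intro mult_mono K2(2) K3(2)) simp_all
    have "norm (c n) = norm (t * D) ^ n * norm p ^ (n choose 2) * (norm (1 / qpoch D p (n + 1)) * norm (1 / qpoch t p (n + 1)))"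
      by (simp add: c_def norm_mult norm_divide norm_power)
    also have "\<dots> \<le> norm (t * D) ^ n * norm p ^ (n choose 2) * (K2 * K3)"
      using b by (intro mult_left_mono) auto
    finally show ?thesis .
  qed
  have Pc_bound: "norm (P z m * c n) \<le> r ^ m * (norm (t * D) ^ n * norm p ^ (n choose 2) * (K2 * K3))"
    if "1 + norm z \<le> r" for z r n m
  proof -
    have "r \<ge> 0" using norm_ge_zero[of z] that by linarith
    thus ?thesis
      unfolding norm_mult[of "P z m"]
      using P_bound[OF that, of m] c_bound[of n] by (intro mult_mono) auto
  qed
  have T_bound: "norm (P z (n + 1) * c n) \<le> r * M r n" if "1 + norm z \<le> r" for z r n
    using Pc_bound[OF that, of "n + 1" n] by (simp add: M_def power_mult_distrib mult_ac)
  have T_summable: "summable (\<lambda>n. P z (n + 1) * c n)" for z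
    by (rule summable_comparison_test'[OF summable_mult[OF M_summable] T_bound[OF order.refl]]) simp
  \<comment> \<open>Every term of \<open>T(zp)\<close> is divisible by \<open>1 - zp\<close>, which cancels the denominator in the functional equation.\<close>
  have P_shift: "P (z * p) (n + 1) = (1 - z * p) * (p ^ n * P z n)" for z n
  proof (induction n)
    case (Suc n)
    have "P (z * p) (Suc n + 1) = P (z * p) (n + 1) * (p ^ Suc n - z * p)"
      by (simp add: P_def)
    also have "\<dots> = (1 - z * p) * (p ^ n * P z n) * (p * (p ^ n - z))"
      unfolding Suc.IH by (simp add: algebra_simps)
    also have "\<dots> = (1 - z * p) * (p ^ Suc n * P z (Suc n))"
      by (simp add: P_def mult_ac)
    finally show ?case .
  qed (simp add: P_def)
  have c'_0: "c' 0 = 1"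
    by (simp add: c'_def numeral_2_eq_2)
  have c'_c: "c' n = c n * ((1 - D * p ^ n) * (1 - t * p ^ n))" for n
  proof -
    have "c n = c' n / ((1 - D * p ^ n) * (1 - t * p ^ n))"
      by (simp add: c_def c'_def qpoch_Suc mult_ac)
    thus ?thesis
      using nz(2,4)[of n] by simp
  qed
  have c'_Suc: "c' (Suc n) = c n * (t * D * p ^ n)" for n
    by (simp add: c_def c'_def numeral_2_eq_2 power_add mult_ac)
  \<comment> \<open>Dividing \<open>T(zp)\<close> by \<open>1 - zp\<close> leaves \<open>\<Sum> p\<^sup>n P(z,n) c(n)\<close>, and
      \<open>1 - p\<^sup>n (D + t) + z D t p\<^sup>n = (1 - Dp\<^sup>n) (1 - tp\<^sup>n) - D t p\<^sup>n (p\<^sup>n - z)\<close>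
      makes the termwise difference \<open>z\<close> times a difference of consecutive values of \<open>c'(n) P(z,n)\<close>.\<close>
  have functional: "T z - (1 - z * D) * (1 - z * t) / (1 - z * p) * T (z * p) = - z"
    if "z * p \<noteq> 1" for z
  proof -
    have s: "summable (\<lambda>n. p ^ n * P z n * c n)"
    proof -
      have "summable (\<lambda>n. 1 / (1 - z * p) * (P (z * p) (n + 1) * c n))"
        by (intro summable_mult T_summable)
      thus ?thesis
        unfolding P_shift using that by (simp add: mult.assoc)
    qed
    have "T (z * p) = (\<Sum>n. (1 - z * p) * (p ^ n * P z n * c n))"
      unfolding T_def P_shift by (simp add: mult_ac)
    also have "\<dots> = (1 - z * p) * (\<Sum>n. p ^ n * P z n * c n)"
      by (rule suminf_mult[OF s])
    finally have "T z - (1 - z * D) * (1 - z * t) / (1 - z * p) * T (z * p) =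
        T z - (1 - z * D) * (1 - z * t) * (\<Sum>n. p ^ n * P z n * c n)"
      using that by simp
    also have "\<dots> = (\<Sum>n. P z (n + 1) * c n - (1 - z * D) * (1 - z * t) * (p ^ n * P z n * c n))"
      unfolding T_def suminf_mult[OF s, symmetric]
      by (rule suminf_diff[OF T_summable summable_mult[OF s]])
    also have "\<dots> = (\<Sum>n. z * (c' (Suc n) * P z (Suc n) - c' n * P z n))"
    proof (rule suminf_cong)
      fix n
      have P_Suc: "P z (Suc n) = P z n * (p ^ n - z)"
        by (simp add: P_def)
      show "P z (n + 1) * c n - (1 - z * D) * (1 - z * t) * (p ^ n * P z n * c n) =
            z * (c' (Suc n) * P z (Suc n) - c' n * P z n)"
        unfolding c'_Suc[of n] c'_c[of n] Suc_eq_plus1[symmetric] P_Suc by (simp add: algebra_simps)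
    qed
    also have "\<dots> = z * (0 - c' 0 * P z 0)"
    proof -
      have "(\<lambda>n. c' (Suc n) * P z (Suc n)) \<longlonglongrightarrow> 0"
      proof -
        have "(\<lambda>n. (t * D * p ^ n) * (P z (n + 1) * c n)) \<longlonglongrightarrow> (t * D * 0) * 0"
          by (intro tendsto_mult tendsto_const LIMSEQ_power_zero p summable_LIMSEQ_zero T_summable)
        thus ?thesis
          by (simp add: c'_Suc mult_ac)
      qed
      hence "(\<lambda>n. c' n * P z n) \<longlonglongrightarrow> 0"
        by (rule LIMSEQ_imp_Suc)
      from telescope_sums[OF this] have "(\<lambda>n. c' (Suc n) * P z (Suc n) - c' n * P z n) sums (0 - c' 0 * P z 0)" .
      from sums_unique[OF sums_mult[OF this, of z]] show ?thesis
        by simp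
    qed
    finally show ?thesis
      by (simp add: c'_0 P_def)
  qed
  have partial: "y * (\<Sum>n<N. G n * p ^ n) = G N * T (y * p ^ N) - T y" for N
  proof (induction N)
    case (Suc N)
    have zp: "y * p ^ N * p \<noteq> 1"
      using yp[of N] by (simp add: mult_ac)
    have G_Suc: "G (Suc N) = G N * ((1 - y * p ^ N * D) * (1 - y * p ^ N * t) / (1 - y * p ^ N * p))"
      by (simp add: G_def qpoch_Suc mult_ac)
    have "y * (\<Sum>n<Suc N. G n * p ^ n) = G N * (T (y * p ^ N) + y * p ^ N) - T y"
      using Suc by (simp add: algebra_simps)
    also have "T (y * p ^ N) + y * p ^ N = 
      (1 - y * p ^ N * D) * (1 - y * p ^ N * t) / (1 - y * p ^ N * p) * T (y * p ^ Suc N)"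
      using functional[OF zp] by (simp add: algebra_simps)
    finally show ?case
      by (simp only: G_Suc mult.assoc)
  qed (simp add: G_def)
  have T_lim: "(\<lambda>N. T (y * p ^ N)) \<longlonglongrightarrow> T 0"
  proof -
    have "eventually (\<lambda>N. summable (\<lambda>n. norm (P (y * p ^ N) (n + 1) * c n))) sequentially \<and>
          summable (\<lambda>n. norm (P 0 (n + 1) * c n)) \<and>
          ((\<lambda>N. suminf (\<lambda>n. P (y * p ^ N) (n + 1) * c n)) \<longlongrightarrow> suminf (\<lambda>n. P 0 (n + 1) * c n)) sequentially"
    proof (rule tannerys_theorem)
      fix n
      have "(\<lambda>N. P (y * p ^ N) (n + 1) * c n) \<longlonglongrightarrow> (\<Prod>k<n + 1. p ^ k - y * 0) * c n"
        unfolding P_def by (intro tendsto_intros LIMSEQ_power_zero p)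
      thus "(\<lambda>N. P (y * p ^ N) (n + 1) * c n) \<longlonglongrightarrow> P 0 (n + 1) * c n"
        by (simp add: P_def)
    next
      show "summable (\<lambda>n. (1 + norm y) * M (1 + norm y) n)"
        by (intro summable_mult M_summable) simp
      have "1 + norm (y * p ^ N) \<le> 1 + norm y" for N
        using p by (simp add: norm_mult norm_power mult_left_le power_le_one)
      from T_bound[OF this]
      show "\<forall>\<^sub>F (n, N) in sequentially \<times>\<^sub>F sequentially.
              norm (P (y * p ^ N) (n + 1) * c n) \<le> (1 + norm y) * M (1 + norm y) n"
        by (intro always_eventually) auto
    qed simp
    thus ?thesis unfolding T_def by blast
  qed
  have T_0: "T 0 = (\<Sum>m. t ^ m / qpoch D p (m + 1))"
  proof -
    \<comment> \<open>The exponents add up as \<open>(n + 1 choose 2) + (n choose 2) = n\<^sup>2\<close>.\<close>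
    have "P 0 (n + 1) * p ^ (n choose 2) = p ^ (n\<^sup>2)" for n
      by (induction n) (simp_all add: P_def power2_eq_square numeral_2_eq_2 power_add mult_ac)
    moreover have "P 0 (n + 1) * c n = (P 0 (n + 1) * p ^ (n choose 2)) * (D * t) ^ n
        / (qpoch D p (n + 1) * qpoch t p (n + 1))" for n
      by (simp only: c_def times_divide_eq_right mult_ac)
    ultimately have "P 0 (n + 1) * c n = p ^ (n\<^sup>2) * (D * t) ^ n / (qpoch D p (n + 1) * qpoch t p (n + 1))" for n
      by simp
    thus ?thesis
      unfolding T_def using sums_unique[OF rogers_fine_special[OF p t D]] by simp
  qed
  have "(\<lambda>N. (G N * T (y * p ^ N) - T y) / y) \<longlonglongrightarrow>
          (qpoch_inf (y * D) p * qpoch_inf (y * t) p / qpoch_inf (y * p) p * T 0 - T y) / y"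
    unfolding G_def by (intro tendsto_intros qpoch_LIMSEQ p T_lim qpoch_inf_nonzero y yp)
  moreover have "(G N * T (y * p ^ N) - T y) / y = (\<Sum>n<N. G n * p ^ n)" for N
    using partial[of N] y by (simp add: field_simps)
  ultimately have "(\<lambda>n. G n * p ^ n) sums
      ((qpoch_inf (y * D) p * qpoch_inf (y * t) p / qpoch_inf (y * p) p * T 0 - T y) / y)"
    by (simp add: sums_def)
  moreover have "T y = (\<Sum>n. (\<Prod>k<n + 1. p ^ k - y) * (t * D) ^ n * p ^ (n choose 2)
                / (qpoch D p (n + 1) * qpoch t p (n + 1)))"
    by (simp add: T_def P_def c_def mult.assoc)
  ultimately show ?sums
    unfolding T_0 G_def by simp
  show ?summable
    using T_summable[of y] by (simp add: P_def c_def mult.assoc)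
qed

section \<open>A limiting case of Heine's transformation\<close>

text \<open>
  Replace \<open>t\<close> by \<open>tp\<^sup>N\<close> on both sides, and let \<open>\<Psi> N\<close> be the series on the left divided by \<open>(-t;p)\<^sub>N\<close> and
  \<open>\<Phi> N\<close> the series on the right.  Both satisfy a recurrence of the form
  \<open>X N + (1 - tp\<^sup>N) * X (Suc N) = const\<close>, so a suitable combination \<open>\<Delta>\<close> satisfies the homogeneous one.
  Its limit \<open>L\<close> then obeys \<open>L = -L\<close>, hence vanishes; and \<open>\<Delta> 0\<close> equals \<open>\<Delta> N\<close> up to the bounded factor
  \<open>(t;p)\<^sub>N\<close> and a sign, so \<open>\<Delta> 0 = 0\<close>.
\<close>

lemma heine_transformation_limit:
  fixes t p :: complex
  assumes p: "norm p < 1" and t: "norm t < 1"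
  shows "(\<lambda>n. qpoch (-1) p n / qpoch p p n * p ^ n / qpoch (-t) p n) sums
     (qpoch_inf (-1) p / (2 * qpoch_inf p p * qpoch_inf (-t) p)
        * (\<Sum>k. t ^ k * p ^ (k choose 2) / qpoch (-p) p k))"
proof -
  define E where "E = qpoch (-t) p"
  define a where "a = (\<lambda>n. qpoch (-1) p n / qpoch p p n)"
  define \<Psi> where "\<Psi> = (\<lambda>N. \<Sum>n. a n * p ^ n / E (n + N))"
  define \<Phi> where "\<Phi> = (\<lambda>N. \<Sum>k. (t * p ^ N) ^ k * p ^ (k choose 2) / qpoch (-p) p k)"
  define C where "C = qpoch_inf (-1) p / qpoch_inf p p"
  define Einf where "Einf = qpoch_inf (-t) p"
  have ne: "- t * p ^ k \<noteq> 1" "p * p ^ k \<noteq> 1" "- p * p ^ k \<noteq> 1" for k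
    using mult_power_neq_1[OF p, of "-t"] mult_power_neq_1[OF p, of p] mult_power_neq_1[OF p, of "-p"] p t
    by simp_all
  have nz: "E n \<noteq> 0" "qpoch p p n \<noteq> 0" "qpoch (-p) p n \<noteq> 0" "Einf \<noteq> 0" "qpoch_inf p p \<noteq> 0" for n
    unfolding E_def Einf_def by (intro qpoch_nonzero qpoch_inf_nonzero p ne)+
  have a_lim: "a \<longlonglongrightarrow> C"
    unfolding a_def C_def by (intro tendsto_intros qpoch_LIMSEQ p nz)
  have E_lim: "E \<longlonglongrightarrow> Einf"
    unfolding E_def Einf_def by (rule qpoch_LIMSEQ[OF p])
  obtain K1 where K1: "K1 > 0" "\<And>n. norm (a n) \<le> K1"
    using convergent_imp_Bseq[OF convergentI[OF a_lim]] by (auto simp: Bseq_def)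
  obtain K2 where K2: "K2 > 0" "\<And>n. norm (1 / E n) \<le> K2"
    unfolding E_def using inverse_qpoch_bounded[OF p ne(1)] by metis
  obtain K3 where K3: "K3 > 0" "\<And>n. norm (1 / qpoch (-p) p n) \<le> K3"
    using inverse_qpoch_bounded[OF p ne(3)] by metis

  have \<Psi>_bound: "norm (a n * p ^ n / E m) \<le> norm p ^ n * (K1 * K2)" for n m
  proof -
    have "norm (a n) * norm (1 / E m) \<le> K1 * K2"
      using K1(1) by (intro mult_mono K1(2) K2(2)) simp_all
    from mult_left_mono[OF this, of "norm p ^ n"] show ?thesis
      by (simp add: norm_mult norm_divide norm_power mult_ac)
  qed
  have \<Psi>_summable_bound: "summable (\<lambda>n. norm p ^ n * (K1 * K2))"
    using p by (intro summable_mult2 summable_geometric) auto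
  have \<Psi>_summable: "summable (\<lambda>n. a n * p ^ n / E (n + N))" for N
    by (rule summable_comparison_test'[OF \<Psi>_summable_bound \<Psi>_bound])
  have \<Phi>_bound: "norm ((t * p ^ N) ^ k * p ^ (k choose 2) / qpoch (-p) p k)
      \<le> norm t ^ k * norm p ^ (k choose 2) * K3" for N k
  proof -
    have "norm (t * p ^ N) \<le> norm t"
      using p by (simp add: norm_mult norm_power mult_left_le power_le_one)
    hence "norm (t * p ^ N) ^ k \<le> norm t ^ k"
      by (intro power_mono) auto
    hence "norm (t * p ^ N) ^ k * norm p ^ (k choose 2) * norm (1 / qpoch (-p) p k)
        \<le> norm t ^ k * norm p ^ (k choose 2) * K3"
      by (intro mult_mono[OF mult_right_mono K3(2)]) auto
    thus ?thesis
      by (simp add: norm_mult norm_divide norm_power)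
  qed
  have \<Phi>_summable_bound: "summable (\<lambda>k. norm t ^ k * norm p ^ (k choose 2) * K3)"
    by (intro summable_mult2 summable_power_mult_power_choose_2) (use p in auto)
  have \<Phi>_summable: "summable (\<lambda>k. (t * p ^ N) ^ k * p ^ (k choose 2) / qpoch (-p) p k)" for N
    by (rule summable_comparison_test'[OF \<Phi>_summable_bound \<Phi>_bound])

  have \<Psi>_rec: "\<Psi> N + (1 - t * p ^ N) * \<Psi> (Suc N) = C / Einf" for N
  proof -
    \<comment> \<open>The recurrence telescopes: the \<open>n\<close>-th summand is \<open>v (Suc n) - v n\<close>, because \<open>a (Suc n) * (1 - p ^ Suc n) = a n * (1 + p ^ n)\<close>.\<close>
    define v where "v = (\<lambda>n. a n * (1 - p ^ n) / E (n + N))"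
    have a_Suc: "a (Suc n) * (1 - p ^ Suc n) = a n * (1 + p ^ n)" for n
    proof -
      have "1 - p ^ Suc n \<noteq> 0"
        using ne(2)[of n] by simp
      thus ?thesis
        by (simp add: a_def qpoch_Suc)
    qed
    have E_Suc: "E (Suc n) = E n * (1 + t * p ^ n)" for n
      by (simp add: E_def qpoch_Suc)
    have E1: "1 + t * p ^ n \<noteq> 0" for n
      using ne(1)[of n] by (simp add: eq_neg_iff_add_eq_0 neg_eq_iff_add_eq_0 add.commute)
    have E_inv: "1 / E n = (1 + t * p ^ n) / E (Suc n)" for n
      using E1[of n] by (simp add: E_Suc)
    have "(\<lambda>n. v (Suc n) - v n) sums (C * (1 - 0) / Einf - v 0)"
      unfolding v_def
      by (intro telescope_sums tendsto_intros a_lim LIMSEQ_power_zero p LIMSEQ_ignore_initial_segment E_lim nz)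
    moreover have "v (Suc n) - v n = a n * p ^ n / E (n + N) + (1 - t * p ^ N) * (a n * p ^ n / E (n + Suc N))" for n
    proof -
      have "v (Suc n) = a n * (1 + p ^ n) / E (Suc (n + N))"
        by (simp only: v_def a_Suc add_Suc)
      moreover have "v n = a n * (1 - p ^ n) * ((1 + t * p ^ (n + N)) / E (Suc (n + N)))"
        using E_inv[of "n + N"] by (simp add: v_def divide_inverse mult.assoc)
      moreover have "a n * p ^ n / E (n + N) = a n * p ^ n * ((1 + t * p ^ (n + N)) / E (Suc (n + N)))"
        using E_inv[of "n + N"] by (simp add: divide_inverse mult.assoc)
      ultimately show ?thesis
        by (simp add: algebra_simps power_add flip: add_divide_distrib diff_divide_distrib)
    qed
    moreover have "v 0 = 0"
      by (simp add: v_def)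
    ultimately have "(\<lambda>n. a n * p ^ n / E (n + N) + (1 - t * p ^ N) * (a n * p ^ n / E (n + Suc N))) sums (C / Einf)"
      by simp
    moreover have "(\<lambda>n. a n * p ^ n / E (n + N) + (1 - t * p ^ N) * (a n * p ^ n / E (n + Suc N)))
       sums (\<Psi> N + (1 - t * p ^ N) * \<Psi> (Suc N))"
      unfolding \<Psi>_def by (intro sums_add sums_mult summable_sums \<Psi>_summable)
    ultimately show ?thesis
      by (rule sums_unique2[symmetric])
  qed

  have \<Phi>_rec: "\<Phi> N + (1 - t * p ^ N) * \<Phi> (Suc N) = 2" for N
  proof -
    define w where "w = (\<lambda>M k. (t * p ^ M) ^ k * p ^ (k choose 2) / qpoch (-p) p k)"
    have w_sums: "w M sums \<Phi> M" for M
      unfolding w_def \<Phi>_def by (rule summable_sums[OF \<Phi>_summable])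
    have "w N (Suc k) + w (Suc N) (Suc k) = t * p ^ N * w (Suc N) k" for k
    proof -
      have n1: "1 + p * p ^ k \<noteq> 0"
        using ne(3)[of k] by (simp add: eq_neg_iff_add_eq_0 neg_eq_iff_add_eq_0 add.commute)
      have "w N (Suc k) + w (Suc N) (Suc k) =
         (t * p ^ N) ^ Suc k * p ^ (Suc k choose 2) * (1 + p * p ^ k) / qpoch (-p) p (Suc k)"
        by (simp add: w_def power_mult_distrib algebra_simps flip: add_divide_distrib)
      also have "\<dots> = (t * p ^ N) ^ Suc k * p ^ (Suc k choose 2) / qpoch (-p) p k"
        using n1 by (simp add: qpoch_Suc)
      also have "\<dots> = t * p ^ N * w (Suc N) k"
        by (simp add: w_def power_mult_distrib numeral_2_eq_2 power_add mult_ac)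
      finally show ?thesis .
    qed
    moreover have "(\<lambda>k. w N (Suc k) + w (Suc N) (Suc k)) sums (\<Phi> N - 1 + (\<Phi> (Suc N) - 1))"
      using sums_split_initial_segment[OF w_sums, of N 1] sums_split_initial_segment[OF w_sums, of "Suc N" 1]
      by (intro sums_add) (simp_all add: w_def numeral_2_eq_2)
    ultimately have "(\<lambda>k. t * p ^ N * w (Suc N) k) sums (\<Phi> N - 1 + (\<Phi> (Suc N) - 1))"
      by simp
    from sums_unique2[OF this sums_mult[OF w_sums]] show ?thesis
      by (simp add: algebra_simps)
  qed

  define \<Delta> where "\<Delta> = (\<lambda>N. 2 * \<Psi> N - C / Einf * \<Phi> N)"
  have \<Delta>_rec: "\<Delta> N = - (1 - t * p ^ N) * \<Delta> (Suc N)" for N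
  proof -
    have a: "\<Psi> N = C / Einf - (1 - t * p ^ N) * \<Psi> (Suc N)" and b: "\<Phi> N = 2 - (1 - t * p ^ N) * \<Phi> (Suc N)"
      using \<Psi>_rec[of N] \<Phi>_rec[of N] by (simp_all add: algebra_simps)
    show ?thesis
      unfolding \<Delta>_def a b by (simp add: algebra_simps add_divide_distrib diff_divide_distrib)
  qed
  have \<Psi>_lim: "\<Psi> \<longlonglongrightarrow> (\<Sum>n. a n * p ^ n / Einf)"
    unfolding \<Psi>_def
  proof (rule tannerys_theorem[THEN conjunct2, THEN conjunct2, OF _ _ \<Psi>_summable_bound])
    fix n
    have "(\<lambda>N. E (N + n)) \<longlonglongrightarrow> Einf"
      by (rule LIMSEQ_ignore_initial_segment[OF E_lim])
    hence "(\<lambda>N. E (n + N)) \<longlonglongrightarrow> Einf"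
      by (simp only: add.commute)
    thus "(\<lambda>N. a n * p ^ n / E (n + N)) \<longlonglongrightarrow> a n * p ^ n / Einf"
      by (intro tendsto_intros nz)
  qed (simp_all add: always_eventually \<Psi>_bound)
  have \<Phi>_lim: "\<Phi> \<longlonglongrightarrow> (\<Sum>k. (t * 0) ^ k * p ^ (k choose 2) / qpoch (-p) p k)"
    unfolding \<Phi>_def
  proof (rule tannerys_theorem[THEN conjunct2, THEN conjunct2, OF _ _ \<Phi>_summable_bound])
    fix k
    show "(\<lambda>N. (t * p ^ N) ^ k * p ^ (k choose 2) / qpoch (-p) p k)
            \<longlonglongrightarrow> (t * 0) ^ k * p ^ (k choose 2) / qpoch (-p) p k"
      by (intro tendsto_intros LIMSEQ_power_zero p nz)
  qed (use \<Phi>_bound in \<open>simp_all add: always_eventually\<close>)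
  obtain L where L: "\<Delta> \<longlonglongrightarrow> L"
    unfolding \<Delta>_def using tendsto_diff[OF tendsto_mult[OF tendsto_const \<Psi>_lim] tendsto_mult[OF tendsto_const \<Phi>_lim]] by blast
  have "(\<lambda>N. - (1 - t * p ^ N) * \<Delta> (Suc N)) \<longlonglongrightarrow> - (1 - t * 0) * L"
    by (intro tendsto_intros LIMSEQ_power_zero p LIMSEQ_Suc L)
  hence "\<Delta> \<longlonglongrightarrow> - L"
    unfolding \<Delta>_rec[symmetric] by simp
  hence "L = - L"
    using L LIMSEQ_unique by blast
  hence L0: "L = 0"
    by simp
  have iter: "\<Delta> 0 = (-1) ^ N * qpoch t p N * \<Delta> N" for N
  proof (induction N)
    case (Suc N)
    show ?case
      unfolding Suc by (subst \<Delta>_rec[of N]) (simp add: qpoch_Suc algebra_simps)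
  qed simp
  have "(\<lambda>N. norm (qpoch t p N) * norm (\<Delta> N)) \<longlonglongrightarrow> norm (qpoch_inf t p) * norm L"
    by (intro tendsto_intros qpoch_LIMSEQ p L)
  moreover have "norm (qpoch t p N) * norm (\<Delta> N) = norm (\<Delta> 0)" for N
    by (subst iter[of N]) (simp add: norm_mult norm_power)
  ultimately have "\<Delta> 0 = 0"
    using L0 LIMSEQ_unique[OF tendsto_const] by fastforce
  hence "\<Psi> 0 = C / (2 * Einf) * \<Phi> 0"
    using nz(4) by (simp add: \<Delta>_def field_simps)
  moreover have "(\<lambda>n. a n * p ^ n / E n) sums \<Psi> 0"
    unfolding \<Psi>_def using summable_sums[OF \<Psi>_summable[of 0]] by simp
  ultimately show ?thesis
    by (simp add: a_def E_def C_def Einf_def \<Phi>_def mult_ac)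
qed

section \<open>Overpartitions as sequences of blocks\<close>

text \<open>
  The non-empty blocks: what an overpartition can contain as its parts of size \<open>k\<close>, listed in order.
  The flag \<open>b\<close> is that of the first occurrence, the only one that may be overlined.
\<close>

fun blocks :: "part_restriction \<Rightarrow> nat \<Rightarrow> (nat \<times> bool) list set" where
  "blocks Unrestricted k = range (\<lambda>(b, c). (k, b) # replicate c (k, False))"
| "blocks Distinct k = {[(k, False)]}"

fun block_gf :: "part_restriction \<Rightarrow> nat \<Rightarrow> 'a :: field \<Rightarrow> 'a" where
  "block_gf Unrestricted k q = 2 * q ^ k / (1 - q ^ k)"
| "block_gf Distinct k q = q ^ k"

text \<open>
  Here \<open>B k\<close> is the set of blocks admitted for the size \<open>k\<close>, with \<open>[]\<close> among them iff the size may be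
  absent.  All conditions on overpartitions considered below, including the one that compares parts of
  different parity once the pivot is fixed, are of this form.
\<close>

definition block_lists :: "(nat \<Rightarrow> (nat \<times> bool) list set) \<Rightarrow> (nat \<times> bool) list set" where
  "block_lists B = {xs. sorted_wrt (\<ge>) (map fst xs) \<and> (\<forall>k. filter (\<lambda>x. fst x = k) xs \<in> B k)}"

abbreviation weight :: "(nat \<times> bool) list \<Rightarrow> nat" where
  "weight xs \<equiv> sum_list (map fst xs)"

lemma blocks_subset_Unrestricted: "blocks r k \<subseteq> blocks Unrestricted k"
proof (cases r)
  case Distinct
  have "[(k, False)] = (\<lambda>(b, c). (k, b) # replicate c (k, False)) (False, 0)"
    by simp
  thus ?thesis
    unfolding Distinct blocks.simps by blast
qed simp

lemma fst_blocks: "b \<in> insert [] (blocks r k) \<Longrightarrow> x \<in> set b \<Longrightarrow> fst x = k"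
  by (cases r) auto

lemma Nil_notin_blocks [simp]: "[] \<notin> blocks r k"
  by (cases r) auto

lemma has_sum_product:
  fixes f :: "'a \<Rightarrow> 'c :: {real_normed_field, banach}" and g :: "'b \<Rightarrow> 'c"
  assumes f: "(f has_sum a) A" "(\<lambda>x. norm (f x)) summable_on A"
    and g: "(g has_sum b) B" "(\<lambda>y. norm (g y)) summable_on B"
  shows "((\<lambda>(x, y). f x * g y) has_sum (a * b)) (A \<times> B)"
    and "(\<lambda>(x, y). norm (f x * g y)) summable_on A \<times> B"
proof -
  show n: "(\<lambda>(x, y). norm (f x * g y)) summable_on A \<times> B"
  proof (rule summable_on_SigmaI)
    show "((\<lambda>y. case (x, y) of (x, y) \<Rightarrow> norm (f x * g y)) has_sum (norm (f x) * infsum (\<lambda>y. norm (g y)) B)) B" for x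
      unfolding case_prod_conv norm_mult by (intro has_sum_cmult_right has_sum_infsum g)
    show "(\<lambda>x. norm (f x) * infsum (\<lambda>y. norm (g y)) B) summable_on A"
      by (intro summable_on_cmult_left f)
  qed simp
  show "((\<lambda>(x, y). f x * g y) has_sum (a * b)) (A \<times> B)"
  proof (rule has_sum_SigmaI)
    show "((\<lambda>y. case (x, y) of (x, y) \<Rightarrow> f x * g y) has_sum (f x * b)) B" for x
      unfolding case_prod_conv by (intro has_sum_cmult_right g)
    show "((\<lambda>x. f x * b) has_sum (a * b)) A"
      by (intro has_sum_cmult_left f)
    show "(\<lambda>(x, y). f x * g y) summable_on A \<times> B"
      by (rule abs_summable_summable) (use n in \<open>simp add: case_prod_unfold\<close>)
  qed
qed

text \<open>
  A block of \<open>c + 1\<close> parts of size \<open>k\<close> has weight \<open>(c + 1) k\<close> and comes in two versions, so an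
  unrestricted block contributes a geometric series with factor \<open>2\<close>.
\<close>

lemma has_sum_blocks:
  fixes q :: "'a :: {real_normed_field, banach}"
  assumes q: "norm q < 1" and k: "k > 0"
  shows "((\<lambda>b. q ^ weight b) has_sum block_gf r k q) (blocks r k)"
    and "((\<lambda>b. norm (q ^ weight b)) has_sum block_gf r k (norm q)) (blocks r k)"
proof -
  have *: "((\<lambda>b. s ^ weight b) has_sum block_gf r k s) (blocks r k)"
    if s: "norm s < 1" for s :: "'b :: {real_normed_field, banach}"
  proof (cases r)
    case Unrestricted
    have sk: "norm (s ^ k) < 1"
      using s k by (simp add: norm_power power_less_one_iff)
    have inj: "inj (\<lambda>(b, c). (k, b) # replicate c (k, False))"
      by (auto simp: inj_def)
    have norm_geo: "summable (\<lambda>c. norm ((s ^ k) ^ Suc c))"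
      using sk by (auto simp: norm_mult norm_power intro!: summable_mult summable_geometric)
    have geo: "((\<lambda>c. (s ^ k) ^ Suc c) has_sum (s ^ k / (1 - s ^ k))) UNIV"
      using sums_mult[OF geometric_sums[OF sk], of "s ^ k"]
      by (intro norm_summable_imp_has_sum[OF norm_geo]) simp
    have "(\<lambda>c. norm ((s ^ k) ^ Suc c)) summable_on UNIV"
      by (rule norm_summable_imp_summable_on) (use norm_geo in simp)
    from has_sum_product(1)[OF has_sum_finite[of "UNIV :: bool set" "\<lambda>_. 1"] _ geo this]
    have "((\<lambda>(b, c). (s ^ k) ^ Suc c) has_sum block_gf r k s) (UNIV :: (bool \<times> nat) set)"
      by (simp add: Unrestricted)
    hence "(((\<lambda>b. s ^ weight b) \<circ> (\<lambda>(b, c). (k, b) # replicate c (k, False))) has_sum block_gf r k s) UNIV"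
      by (simp add: o_def case_prod_unfold sum_list_replicate power_add power_mult mult.commute)
    hence "((\<lambda>b. s ^ weight b) has_sum block_gf r k s) (range (\<lambda>(b, c). (k, b) # replicate c (k, False)))"
      using has_sum_reindex[OF inj] by blast
    thus ?thesis
      by (simp add: Unrestricted)
  next
    case Distinct
    show ?thesis
      using has_sum_finite[of "{[(k, False)]}" "\<lambda>b. s ^ weight b"] by (simp add: Distinct)
  qed
  show "((\<lambda>b. q ^ weight b) has_sum block_gf r k q) (blocks r k)"
    using *[of q] q .
  show "((\<lambda>b. norm (q ^ weight b)) has_sum block_gf r k (norm q)) (blocks r k)"
    using *[of "norm q"] q by (simp add: norm_power)
qed

text \<open>
  In a non-increasing list the parts of the largest admitted size come first.
\<close>

lemma sorted_split_top_block:
  fixes xs :: "(nat \<times> bool) list"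
  assumes "sorted_wrt (\<ge>) (map fst xs)" "\<forall>x\<in>set xs. fst x \<le> k"
  shows "filter (\<lambda>x. fst x = k) xs @ filter (\<lambda>x. fst x \<noteq> k) xs = xs"
  using assms
proof (induction xs)
  case (Cons x xs)
  show ?case
  proof (cases "fst x = k")
    case False
    hence "fst x < k"
      using Cons.prems(2) by (simp add: order.not_eq_order_implies_strict)
    moreover have "fst y \<le> fst x" if "y \<in> set xs" for y
      using Cons.prems(1) that by auto
    ultimately have "fst y \<noteq> k" if "y \<in> set xs" for y
      using that by fastforce
    with False show ?thesis
      by (simp add: filter_empty_conv filter_id_conv)
  qed (use Cons in simp)
qed simp

text \<open>
  Allowing one more part size amounts to prefixing an independently chosen block; hence the generating
  function is multiplied by that of the block.
\<close>

lemma truncated_block_lists_Suc: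
  fixes B :: "nat \<Rightarrow> (nat \<times> bool) list set"
  assumes B: "\<And>b x. b \<in> B (Suc N) \<Longrightarrow> x \<in> set b \<Longrightarrow> fst x = Suc N"
  shows "bij_betw (\<lambda>(b, xs). b @ xs) (B (Suc N) \<times> block_lists (\<lambda>k. if k \<le> N then B k else {[]}))
           (block_lists (\<lambda>k. if k \<le> Suc N then B k else {[]}))"
proof -
  define trunc where "trunc = (\<lambda>N. block_lists (\<lambda>k. if k \<le> N then B k else {[]}))"
  have le: "fst x \<le> M" if "xs \<in> trunc M" "x \<in> set xs" for xs x M
  proof (rule ccontr)
    assume "\<not> fst x \<le> M"
    hence "filter (\<lambda>y. fst y = fst x) xs = []"
      using that by (auto simp: trunc_def block_lists_def dest!: spec[of _ "fst x"])
    thus False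
      using that by (auto simp: filter_empty_conv)
  qed
  have filter_append: "filter (\<lambda>x. fst x = k) (b @ xs) = (if k = Suc N then b else filter (\<lambda>x. fst x = k) xs)"
    if "b \<in> B (Suc N)" "xs \<in> trunc N" for b xs k
  proof -
    have "filter (\<lambda>x. fst x = k) b = (if k = Suc N then b else [])"
      using B[OF that(1)] by (auto simp: filter_empty_conv filter_id_conv)
    moreover have "filter (\<lambda>x. fst x = k) xs = []" if "k = Suc N"
      using le[OF \<open>xs \<in> trunc N\<close>] that by (fastforce simp: filter_empty_conv)
    ultimately show ?thesis
      by simp
  qed
  have split: "(filter (\<lambda>x. fst x = Suc N) (case (b, xs) of (b, xs) \<Rightarrow> b @ xs),
      filter (\<lambda>x. fst x \<noteq> Suc N) (case (b, xs) of (b, xs) \<Rightarrow> b @ xs)) = (b, xs)"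
    if bx: "b \<in> B (Suc N)" "xs \<in> trunc N" for b xs
  proof -
    have "filter (\<lambda>x. fst x \<noteq> Suc N) b = []" "filter (\<lambda>x. fst x \<noteq> Suc N) xs = xs"
      using B[OF bx(1)] le[OF bx(2)] by (fastforce simp: filter_empty_conv filter_id_conv)+
    thus ?thesis
      using filter_append[OF bx, of "Suc N"] by simp
  qed
  have join: "b @ xs \<in> trunc (Suc N)" if bx: "b \<in> B (Suc N)" "xs \<in> trunc N" for b xs
  proof -
    have "map fst b = replicate (length b) (Suc N)"
      using B[OF bx(1)] by (intro replicate_eqI) auto
    moreover have "fst x \<le> Suc N" if "x \<in> set xs" for x
      using le[OF bx(2) that] by simp
    moreover have "sorted_wrt (\<ge>) (replicate n (Suc N))" for n
      by (induction n) auto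
    ultimately have "sorted_wrt (\<ge>) (map fst (b @ xs))"
      using bx(2) by (auto simp: sorted_wrt_append trunc_def block_lists_def)
    moreover have "filter (\<lambda>x. fst x = k) (b @ xs) \<in> (if k \<le> Suc N then B k else {[]})" for k
      unfolding filter_append[OF bx] using bx
      by (auto simp: trunc_def block_lists_def le_Suc_eq dest!: spec[of _ k] split: if_splits)
    ultimately show "b @ xs \<in> trunc (Suc N)"
      by (simp add: trunc_def block_lists_def)
  qed
  have parts: "filter (\<lambda>x. fst x = Suc N) xs \<in> B (Suc N)" "filter (\<lambda>x. fst x \<noteq> Suc N) xs \<in> trunc N"
    if xs: "xs \<in> trunc (Suc N)" for xs
  proof -
    show "filter (\<lambda>x. fst x = Suc N) xs \<in> B (Suc N)"
      using xs by (auto simp: trunc_def block_lists_def dest!: spec[of _ "Suc N"])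
    have "sorted_wrt (\<ge>) (map fst (filter (\<lambda>x. fst x \<noteq> Suc N) xs))"
      using xs by (auto simp: trunc_def block_lists_def sorted_wrt_map sorted_wrt_filter)
    moreover have "filter (\<lambda>x. fst x = k) (filter (\<lambda>x. fst x \<noteq> Suc N) xs) \<in> (if k \<le> N then B k else {[]})" for k
    proof -
      have "filter (\<lambda>x. fst x = k) (filter (\<lambda>x. fst x \<noteq> Suc N) xs) =
         (if k = Suc N then [] else filter (\<lambda>x. fst x = k) xs)"
        by (auto simp: filter_empty_conv intro: filter_cong)
      thus ?thesis
        using xs by (auto simp: trunc_def block_lists_def le_Suc_eq dest!: spec[of _ k] split: if_splits)
    qed
    ultimately show "filter (\<lambda>x. fst x \<noteq> Suc N) xs \<in> trunc N"
      by (simp add: trunc_def block_lists_def)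
  qed
  have "bij_betw (\<lambda>(b, xs). b @ xs) (B (Suc N) \<times> trunc N) (trunc (Suc N))"
  proof (rule bij_betw_byWitness[where f' = "\<lambda>xs. (filter (\<lambda>x. fst x = Suc N) xs, filter (\<lambda>x. fst x \<noteq> Suc N) xs)"])
    show "\<forall>a\<in>B (Suc N) \<times> trunc N. (filter (\<lambda>x. fst x = Suc N) (case a of (b, xs) \<Rightarrow> b @ xs),
        filter (\<lambda>x. fst x \<noteq> Suc N) (case a of (b, xs) \<Rightarrow> b @ xs)) = a"
      using split by blast
    show "\<forall>xs\<in>trunc (Suc N). (case (filter (\<lambda>x. fst x = Suc N) xs, filter (\<lambda>x. fst x \<noteq> Suc N) xs)
        of (b, xs) \<Rightarrow> b @ xs) = xs"
    proof
      fix xs assume xs: "xs \<in> trunc (Suc N)"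
      have "sorted_wrt (\<ge>) (map fst xs)"
        using xs by (simp add: trunc_def block_lists_def)
      from sorted_split_top_block[OF this, of "Suc N"] le[OF xs]
      show "(case (filter (\<lambda>x. fst x = Suc N) xs, filter (\<lambda>x. fst x \<noteq> Suc N) xs) of (b, xs) \<Rightarrow> b @ xs) = xs"
        by simp
    qed
    show "(\<lambda>(b, xs). b @ xs) ` (B (Suc N) \<times> trunc N) \<subseteq> trunc (Suc N)"
      by (auto simp: image_subset_iff intro!: join)
    show "(\<lambda>xs. (filter (\<lambda>x. fst x = Suc N) xs, filter (\<lambda>x. fst x \<noteq> Suc N) xs)) ` trunc (Suc N)
        \<subseteq> B (Suc N) \<times> trunc N"
      by (auto simp only: image_subset_iff mem_Times_iff fst_conv snd_conv intro!: parts)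
  qed
  thus ?thesis
    by (simp add: trunc_def)
qed

lemma has_sum_truncated_block_lists:
  fixes q :: "'a :: {real_normed_field, banach}"
  assumes B0: "B 0 = {[]}"
    and B: "\<And>k b x. b \<in> B k \<Longrightarrow> x \<in> set b \<Longrightarrow> fst x = k"
    and W: "\<And>k. k > 0 \<Longrightarrow> ((\<lambda>b. q ^ weight b) has_sum W k) (B k)"
    and W': "\<And>k. k > 0 \<Longrightarrow> (\<lambda>b. norm (q ^ weight b)) summable_on B k"
  shows "((\<lambda>xs. q ^ weight xs) has_sum (\<Prod>k=1..N. W k)) (block_lists (\<lambda>k. if k \<le> N then B k else {[]}))
    \<and> (\<lambda>xs. norm (q ^ weight xs)) summable_on (block_lists (\<lambda>k. if k \<le> N then B k else {[]}))"
    (is "?H N \<and> ?S N")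
proof (induction N)
  case 0
  have "block_lists (\<lambda>k. if k \<le> 0 then B k else {[]}) = {[]}"
  proof -
    have "xs = []" if "\<forall>k. filter (\<lambda>x. fst x = k) xs \<in> {[]}" for xs :: "(nat \<times> bool) list"
      using that[rule_format, of "fst (hd xs)"] by (cases xs) auto
    hence "block_lists (\<lambda>_. {[]}) \<subseteq> {[]}"
      unfolding block_lists_def by blast
    moreover have "[] \<in> block_lists (\<lambda>_. {[]})"
      by (simp add: block_lists_def)
    moreover have "(\<lambda>k. if k \<le> 0 then B k else {[]}) = (\<lambda>_. {[]})"
      using B0 by (intro ext) simp
    ultimately show ?thesis
      by (simp only: subset_singleton_iff) blast
  qed
  thus ?case
    using has_sum_finite[of "{[]}" "\<lambda>xs. q ^ weight xs"] by simp
next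
  case (Suc N)
  have bij: "bij_betw (\<lambda>(b, xs). b @ xs) (B (Suc N) \<times> block_lists (\<lambda>k. if k \<le> N then B k else {[]}))
           (block_lists (\<lambda>k. if k \<le> Suc N then B k else {[]}))"
    by (rule truncated_block_lists_Suc) (rule B)
  note prod = has_sum_product[OF W[of "Suc N"] W'[of "Suc N"] Suc[THEN conjunct1] Suc[THEN conjunct2]]
  have eq: "(\<lambda>(b, xs). q ^ weight b * q ^ weight xs) = (\<lambda>z. q ^ weight (case z of (b, xs) \<Rightarrow> b @ xs))"
    by (intro ext) (simp add: power_add case_prod_unfold)
  have eq': "(\<lambda>(b, xs). norm (q ^ weight b * q ^ weight xs)) = (\<lambda>z. norm (q ^ weight (case z of (b, xs) \<Rightarrow> b @ xs)))"
    by (intro ext) (simp add: power_add case_prod_unfold)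
  have "((\<lambda>xs. q ^ weight xs) has_sum (W (Suc N) * (\<Prod>k=1..N. W k)))
      (block_lists (\<lambda>k. if k \<le> Suc N then B k else {[]}))"
    by (rule iffD1[OF has_sum_reindex_bij_betw[OF bij]]) (use prod(1) in \<open>simp only: eq zero_less_Suc\<close>)
  hence "?H (Suc N)"
    by (simp add: mult.commute)
  moreover have "?S (Suc N)"
    by (rule iffD1[OF summable_on_reindex_bij_betw[OF bij]]) (use prod(2) in \<open>simp only: eq' zero_less_Suc\<close>)
  ultimately show ?case ..
qed

lemma eventually_subset_of_finite:
  assumes "finite X" "\<And>x. x \<in> X \<Longrightarrow> eventually (\<lambda>n. x \<in> A n) F"
  shows "eventually (\<lambda>n. X \<subseteq> A n) F"
  using eventually_ball_finite[OF assms(1), of "\<lambda>n x. x \<in> A n" F] assms(2) by (simp add: subset_iff Ball_def)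

text \<open>
  The sets \<open>A' n\<close> have to exhaust \<open>A\<close> only pointwise, and to lie inside it only eventually: with a
  pivot \<open>m\<close> the truncations below \<open>m\<close> are not subsets of the full set, as they lack the mandatory
  block of size \<open>m\<close>.
\<close>

lemma has_sum_exhaustion:
  fixes f :: "'a \<Rightarrow> 'b :: {comm_monoid_add, metric_space}"
  assumes f: "(f has_sum s) A"
    and A: "\<And>n. (f has_sum S n) (A' n)"
    and sub: "eventually (\<lambda>n. A' n \<subseteq> A) sequentially"
    and cover: "\<And>x. x \<in> A \<Longrightarrow> eventually (\<lambda>n. x \<in> A' n) sequentially"
  shows "S \<longlonglongrightarrow> s"
proof (rule tendstoI)
  fix e :: real assume e: "e > 0"
  have "eventually (\<lambda>Y. dist (sum f Y) s < e / 2) (finite_subsets_at_top A)"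
    by (rule tendstoD[OF f[unfolded has_sum_def]]) (use e in simp)
  hence "\<exists>X. finite X \<and> X \<subseteq> A \<and> (\<forall>Y. finite Y \<and> X \<subseteq> Y \<and> Y \<subseteq> A \<longrightarrow> dist (sum f Y) s < e / 2)"
    by (simp only: eventually_finite_subsets_at_top)
  then obtain X where X: "finite X" "X \<subseteq> A"
    "\<And>Y. finite Y \<and> X \<subseteq> Y \<and> Y \<subseteq> A \<Longrightarrow> dist (sum f Y) s < e / 2"
    by (elim exE conjE) (rule that; blast)
  have "eventually (\<lambda>n. X \<subseteq> A' n) sequentially"
    by (rule eventually_subset_of_finite[OF X(1)]) (use X(2) cover in blast)
  with sub show "eventually (\<lambda>n. dist (S n) s < e) sequentially"
  proof eventually_elim
    case (elim n)
    have "dist (S n) s \<le> e / 2"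
    proof (rule tendsto_upperbound)
      show "((\<lambda>Y. dist (sum f Y) s) \<longlongrightarrow> dist (S n) s) (finite_subsets_at_top (A' n))"
        using A[of n] by (intro tendsto_dist tendsto_const) (simp add: has_sum_def)
      show "eventually (\<lambda>Y. dist (sum f Y) s \<le> e / 2) (finite_subsets_at_top (A' n))"
        unfolding eventually_finite_subsets_at_top
      proof (intro exI[of _ X] conjI allI impI)
        show "dist (sum f Y) s \<le> e / 2" if "finite Y \<and> X \<subseteq> Y \<and> Y \<subseteq> A' n" for Y
          using X(3)[of Y] that elim by (intro less_imp_le) blast
      qed (use X elim in auto)
    qed simp
    with e show ?case by simp
  qed
qed

text \<open>
  No part exceeds the weight, so nothing is lost by truncating at the weight.
\<close>

lemma eventually_truncation:
  assumes "xs \<in> block_lists B"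
  shows "eventually (\<lambda>N. xs \<in> block_lists (\<lambda>k. if k \<le> N then B k else {[]})) sequentially"
proof -
  have "xs \<in> block_lists (\<lambda>k. if k \<le> N then B k else {[]})" if "N \<ge> weight xs" for N
  proof -
    have "filter (\<lambda>x. fst x = k) xs = []" if "k > N" for k
      using that \<open>N \<ge> weight xs\<close> member_le_sum_list[of _ "map fst xs"] by (fastforce simp: filter_empty_conv)
    thus ?thesis
      using assms by (auto simp: block_lists_def)
  qed
  thus ?thesis
    unfolding eventually_sequentially by blast
qed

definition all_blocks :: "nat \<Rightarrow> (nat \<times> bool) list set" where
  "all_blocks k = (if k = 0 then {[]} else insert [] (blocks Unrestricted k))"

lemma has_sum_optional_blocks:
  fixes q :: "'a :: {real_normed_field, banach}"
  assumes q: "norm q < 1" and k: "k > 0"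
  shows "((\<lambda>b. q ^ weight b) has_sum (1 + block_gf r k q)) (insert [] (blocks r k))"
    and "(\<lambda>b. norm (q ^ weight b)) summable_on insert [] (blocks r k)"
proof -
  have "((\<lambda>b. q ^ weight b) has_sum (sum (\<lambda>b. q ^ weight b) {[]} + block_gf r k q)) ({[]} \<union> blocks r k)"
    by (intro has_sum_Un_disjoint has_sum_finite has_sum_blocks q k) auto
  thus "((\<lambda>b. q ^ weight b) has_sum (1 + block_gf r k q)) (insert [] (blocks r k))"
    by simp
  show "(\<lambda>b. norm (q ^ weight b)) summable_on insert [] (blocks r k)"
    using has_sum_imp_summable[OF has_sum_blocks(2)[OF q k]] by (simp add: summable_on_insert_iff)
qed

text \<open>
  All other families are subsets of this one, so this is the only place where absolute convergence
  over an infinite set of overpartitions is established.  The finite products of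
  \<open>1 + 2r\<^sup>k / (1 - r\<^sup>k)\<close> are bounded since each factor is at most \<open>exp (2r\<^sup>k / (1 - r))\<close>.
\<close>

lemma summable_all_overpartitions:
  fixes q :: "'a :: {real_normed_field, banach}"
  assumes q: "norm q < 1"
  shows "(\<lambda>xs. norm (q ^ weight xs)) summable_on block_lists all_blocks"
proof (rule nonneg_bdd_above_summable_on)
  define r where "r = norm q"
  define W where "W = (\<lambda>k. 1 + block_gf Unrestricted k r)"
  have r: "0 \<le> r" "r < 1" "norm r < 1"
    using q by (auto simp: r_def)
  have H: "((\<lambda>xs. r ^ weight xs) has_sum (\<Prod>k=1..N. W k))
        (block_lists (\<lambda>k. if k \<le> N then all_blocks k else {[]}))" for N
    by (rule has_sum_truncated_block_lists[THEN conjunct1])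
       (use has_sum_optional_blocks[OF r(3), of _ Unrestricted] fst_blocks[of _ Unrestricted]
         in \<open>auto simp: all_blocks_def W_def split: if_splits\<close>)
  have W_le: "(\<Prod>k=1..N. W k) \<le> exp (2 / (1 - r) * (1 / (1 - r)))" for N
  proof -
    have "(\<Prod>k=1..N. W k) \<le> (\<Prod>k=1..N. exp (2 / (1 - r) * r ^ k))"
    proof (rule prod_mono, safe)
      fix k assume "k \<in> {1..N}"
      hence k: "r ^ k \<le> r"
        using r power_decreasing[of 1 k r] by simp
      show "0 \<le> W k"
        using k r by (auto simp: W_def intro!: add_nonneg_nonneg divide_nonneg_nonneg)
      have "2 * r ^ k / (1 - r ^ k) \<le> 2 * r ^ k / (1 - r)"
        using k r by (intro divide_left_mono mult_pos_pos) auto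
      hence "W k \<le> 1 + 2 / (1 - r) * r ^ k"
        by (simp add: W_def)
      also have "\<dots> \<le> exp (2 / (1 - r) * r ^ k)"
        by (rule exp_ge_add_one_self)
      finally show "W k \<le> exp (2 / (1 - r) * r ^ k)" .
    qed
    also have "\<dots> = exp (2 / (1 - r) * (\<Sum>k=1..N. r ^ k))"
      by (simp add: exp_sum sum_distrib_left)
    also have "(\<Sum>k=1..N. r ^ k) \<le> (\<Sum>k. r ^ k)"
      using r by (intro sum_le_suminf summable_geometric) auto
    hence "(\<Sum>k=1..N. r ^ k) \<le> 1 / (1 - r)"
      using r by (simp add: suminf_geometric)
    hence "exp (2 / (1 - r) * (\<Sum>k=1..N. r ^ k)) \<le> exp (2 / (1 - r) * (1 / (1 - r)))"
      unfolding exp_le_cancel_iff using r by (intro mult_left_mono) auto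
    finally show ?thesis .
  qed
  show "bdd_above (sum (\<lambda>xs. norm (q ^ weight xs)) ` {F. F \<subseteq> block_lists all_blocks \<and> finite F})"
  proof (rule bdd_aboveI2)
    fix F assume "F \<in> {F. F \<subseteq> block_lists all_blocks \<and> finite F}"
    hence F: "F \<subseteq> block_lists all_blocks" "finite F"
      by auto
    have "eventually (\<lambda>N. F \<subseteq> block_lists (\<lambda>k. if k \<le> N then all_blocks k else {[]})) sequentially"
      by (rule eventually_subset_of_finite[OF F(2)]) (use F(1) eventually_truncation in blast)
    then obtain N where N: "F \<subseteq> block_lists (\<lambda>k. if k \<le> N then all_blocks k else {[]})"
      by (auto simp: eventually_sequentially)
    have "(\<Sum>xs\<in>F. norm (q ^ weight xs)) = (\<Sum>xs\<in>F. r ^ weight xs)"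
      by (simp add: r_def norm_power)
    also have "\<dots> \<le> (\<Prod>k=1..N. W k)"
      using finite_sum_le_has_sum[OF H F(2) N] r by simp
    also note W_le
    finally show "(\<Sum>xs\<in>F. norm (q ^ weight xs)) \<le> exp (2 / (1 - r) * (1 / (1 - r)))" .
  qed
qed simp

section \<open>Splitting by the largest part of the lower parity\<close>

lemma block_lists_mono: "(\<And>k. B k \<subseteq> B' k) \<Longrightarrow> block_lists B \<subseteq> block_lists B'"
  unfolding block_lists_def by blast

lemma fst_all_blocks: "b \<in> all_blocks k \<Longrightarrow> x \<in> set b \<Longrightarrow> fst x = k"
  using fst_blocks[of b Unrestricted k x] by (simp add: all_blocks_def split: if_splits)

lemma summable_block_lists:
  fixes q :: "'a :: {real_normed_field, banach}"
  assumes "norm q < 1" "\<And>k. B k \<subseteq> all_blocks k"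
  shows "(\<lambda>xs. norm (q ^ weight xs)) summable_on block_lists B"
  using summable_on_subset[OF summable_all_overpartitions[OF assms(1)] block_lists_mono[OF assms(2)]] .

text \<open>
  All sizes above some \<open>m\<close> have to be optional: if infinitely many sizes were mandatory, \<open>block_lists B\<close>
  would be empty although the truncations need not be.
\<close>

lemma block_lists_product:
  fixes q :: "'a :: {real_normed_field, banach}"
  assumes q: "norm q < 1" and B: "\<And>k. B k \<subseteq> all_blocks k" and B0: "B 0 = {[]}"
    and ev: "\<And>k. k > m \<Longrightarrow> [] \<in> B k"
    and W: "\<And>k. k > 0 \<Longrightarrow> ((\<lambda>b. q ^ weight b) has_sum W k) (B k)"
  shows "(\<lambda>N. \<Prod>k=1..N. W k) \<longlonglongrightarrow> infsum (\<lambda>xs. q ^ weight xs) (block_lists B)"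
proof (rule has_sum_exhaustion)
  show "((\<lambda>xs. q ^ weight xs) has_sum infsum (\<lambda>xs. q ^ weight xs) (block_lists B)) (block_lists B)"
    by (rule has_sum_infsum, rule abs_summable_summable, rule summable_block_lists[OF q B])
  have B': "\<And>k b x. b \<in> B k \<Longrightarrow> x \<in> set b \<Longrightarrow> fst x = k"
    using B fst_all_blocks by blast
  show "((\<lambda>xs. q ^ weight xs) has_sum (\<Prod>k=1..N. W k)) (block_lists (\<lambda>k. if k \<le> N then B k else {[]}))" for N
  proof (rule has_sum_truncated_block_lists[THEN conjunct1])
    fix k :: nat assume "k > 0"
    with B[of k] have "B k \<subseteq> insert [] (blocks Unrestricted k)"
      by (simp add: all_blocks_def)
    thus "(\<lambda>b. norm (q ^ weight b)) summable_on B k"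
      using summable_on_subset[OF has_sum_optional_blocks(2)[OF q \<open>k > 0\<close>]] by blast
  qed (use B0 B' W in blast)+
  show "\<forall>\<^sub>F N in sequentially. block_lists (\<lambda>k. if k \<le> N then B k else {[]}) \<subseteq> block_lists B"
    unfolding eventually_sequentially
    by (intro exI[of _ m] allI impI block_lists_mono) (use ev in auto)
qed (rule eventually_truncation)

text \<open>
  This makes the conditions on overlined parts local: they only compare parts of the same size.
\<close>

lemma sorted_wrt_iff_blocks:
  assumes "\<And>a b. fst a \<noteq> fst b \<Longrightarrow> R a b"
  shows "sorted_wrt R xs \<longleftrightarrow> (\<forall>k. sorted_wrt R (filter (\<lambda>x. fst x = k) xs))"
proof (induction xs)
  case (Cons a xs)
  have "(\<forall>b\<in>set xs. R a b) \<longleftrightarrow> (\<forall>b\<in>set (filter (\<lambda>x. fst x = fst a) xs). R a b)"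
  proof (intro iffI ballI)
    fix b assume "\<forall>b\<in>set (filter (\<lambda>x. fst x = fst a) xs). R a b" "b \<in> set xs"
    thus "R a b"
      using assms[of a b] by (cases "fst a = fst b"; cases b) auto
  qed simp
  thus ?case
    using Cons.IH by (auto split: if_splits)
qed simp

lemma overlined_block_iff:
  assumes "\<forall>x\<in>set b. fst x = k"
  shows "sorted_wrt (\<lambda>u v. snd v \<longrightarrow> fst u \<noteq> fst v) b \<longleftrightarrow> b \<in> insert [] (blocks Unrestricted k)"
proof
  assume sorted: "sorted_wrt (\<lambda>u v. snd v \<longrightarrow> fst u \<noteq> fst v) b"
  show "b \<in> insert [] (blocks Unrestricted k)"
  proof (cases b)
    case (Cons u vs)
    have "v = (k, False)" if "v \<in> set vs" for v
      using sorted assms that by (cases v) (auto simp: Cons)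
    hence "vs = replicate (length vs) (k, False)"
      by (intro replicate_eqI) auto
    moreover have "u = (k, snd u)"
      using assms by (cases u) (simp add: Cons)
    ultimately have "b = (\<lambda>(b, c). (k, b) # replicate c (k, False)) (snd u, length vs)"
      using Cons by simp
    thus ?thesis
      unfolding blocks.simps by blast
  qed simp
next
  have "sorted_wrt (\<lambda>u v. snd v \<longrightarrow> fst u \<noteq> fst v) (replicate c (k, False))" for c
    by (induction c) auto
  thus "sorted_wrt (\<lambda>u v. snd v \<longrightarrow> fst u \<noteq> fst v) b" if "b \<in> insert [] (blocks Unrestricted k)"
    using that by auto
qed

lemma obeys_Distinct_iff_blocks:
  "obeys x Distinct xs \<longleftrightarrow>
     (\<forall>k. has_parity x k \<longrightarrow> filter (\<lambda>u. fst u = k) xs \<in> insert [] (blocks Distinct k))"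
proof (induction xs)
  case (Cons u xs)
  obtain a b where u: "u = (a, b)" by force
  show ?case
  proof (cases "has_parity x a")
    case False
    hence "obeys x Distinct (u # xs) \<longleftrightarrow> obeys x Distinct xs"
      by (auto simp: u)
    moreover have "filter (\<lambda>u. fst u = k) (u # xs) = filter (\<lambda>u. fst u = k) xs" if "has_parity x k" for k
      using that False by (auto simp: u)
    ultimately show ?thesis
      using Cons.IH by (simp only:) auto
  next
    case True
    have "obeys x Distinct (u # xs) \<longleftrightarrow> filter (\<lambda>u. fst u = a) xs = [] \<and> \<not> b \<and> obeys x Distinct xs"
      using True by (force simp: u filter_empty_conv)
    also have "\<dots> \<longleftrightarrow> (\<forall>k. has_parity x k \<longrightarrow> filter (\<lambda>v. fst v = k) (u # xs) \<in> insert [] (blocks Distinct k))"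
      unfolding Cons.IH using True by (auto simp: u)
    finally show ?thesis .
  qed
qed simp

text \<open>
  The blocks admitted when \<open>m\<close> is the largest part of parity \<open>x\<close>; the value \<open>m = 0\<close> stands for
  overpartitions without parts of parity \<open>x\<close>.  The block of size \<open>m\<close> itself must not be empty.
\<close>

definition pivot_blocks ::
    "part_parity \<Rightarrow> part_restriction \<Rightarrow> part_parity \<Rightarrow> part_restriction \<Rightarrow> nat \<Rightarrow> nat \<Rightarrow> (nat \<times> bool) list set" where
  "pivot_blocks x y z w m k =
     (if k = 0 then {[]}
      else if k = m then blocks y k
      else if k < m \<and> has_parity x k then insert [] (blocks y k)
      else if k > m \<and> has_parity z k then insert [] (blocks w k)
      else {[]})"

lemma has_parity_other: "x \<noteq> z \<Longrightarrow> has_parity z k \<longleftrightarrow> \<not> has_parity x k"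
  by (cases x; cases z) auto

lemma pivot_blocks_trivial:
  assumes "x \<noteq> z" and "k = 0 \<or> k < m \<and> \<not> has_parity x k \<or> m < k \<and> has_parity x k"
  shows "pivot_blocks x y z w m k = {[]}"
  using assms(2) has_parity_other[OF assms(1), of k] unfolding pivot_blocks_def
  by (elim disjE) simp_all

lemma pivot_separates:
  assumes "x \<noteq> z" "m = 0 \<or> has_parity x m" "b \<in> pivot_blocks x y z w m k" "b \<noteq> []"
  shows "has_parity x k \<Longrightarrow> k \<le> m" and "has_parity z k \<Longrightarrow> m < k"
proof -
  have "\<not> (k = 0 \<or> k < m \<and> \<not> has_parity x k \<or> m < k \<and> has_parity x k)"
    using pivot_blocks_trivial[OF assms(1), of k m y w] assms(3,4) by blast
  with assms(2) have "has_parity x k \<longrightarrow> k \<le> m" "\<not> has_parity x k \<longrightarrow> m < k"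
    using linorder_less_linear[of k m] by (blast intro: leI)+
  with has_parity_other[OF assms(1), of k]
  show "has_parity x k \<Longrightarrow> k \<le> m" and "has_parity z k \<Longrightarrow> m < k"
    by blast+
qed

lemma Nil_in_pivot_blocks: "k \<noteq> m \<Longrightarrow> [] \<in> pivot_blocks x y z w m k"
  by (simp add: pivot_blocks_def)

definition separated_overpartitions ::
    "part_parity \<Rightarrow> part_restriction \<Rightarrow> part_parity \<Rightarrow> part_restriction \<Rightarrow> nat \<Rightarrow> (nat \<times> bool) list set" where
  "separated_overpartitions x y z w n =
    {xs. is_overpartition xs n \<and> separated_by_parity (map fst xs) \<and>
         parity_above z x (map fst xs) \<and> obeys x y xs \<and> obeys z w xs}"

text \<open>
  Apart from the comparison between the two parities, membership only depends on the individual blocks: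
  the restriction \<open>y\<close> governs the sizes of parity \<open>x\<close>, and \<open>w\<close> those of parity \<open>z\<close>.
\<close>

lemma separated_overpartitions_iff_blocks:
  assumes xz: "x \<noteq> z"
  shows "xs \<in> separated_overpartitions x y z w n \<longleftrightarrow>
     weight xs = n \<and> parity_above z x (map fst xs) \<and>
     xs \<in> block_lists (\<lambda>k. if k = 0 then {[]} else insert [] (blocks (if has_parity x k then y else w) k))"
proof -
  let ?f = "\<lambda>k. filter (\<lambda>u. fst u = k) xs"
  have sep: "separated_by_parity (map fst xs)" if "parity_above z x (map fst xs)"
    using that xz by (cases x; cases z) (auto simp: separated_by_parity_def)
  have pos: "(\<forall>k\<in>set (map fst xs). k > 0) \<longleftrightarrow> ?f 0 = []"
    by (auto simp: filter_empty_conv)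
  have "(\<forall>i<length xs. snd (xs ! i) \<longrightarrow> (\<forall>j<i. fst (xs ! j) \<noteq> fst (xs ! i)))
      \<longleftrightarrow> sorted_wrt (\<lambda>u v. snd v \<longrightarrow> fst u \<noteq> fst v) xs"
    unfolding sorted_wrt_iff_nth_less by blast
  also have "\<dots> \<longleftrightarrow> (\<forall>k. sorted_wrt (\<lambda>u v. snd v \<longrightarrow> fst u \<noteq> fst v) (?f k))"
    by (rule sorted_wrt_iff_blocks) simp
  also have "\<dots> \<longleftrightarrow> (\<forall>k. ?f k \<in> insert [] (blocks Unrestricted k))"
    by (intro all_cong1 overlined_block_iff) auto
  finally have over: "(\<forall>i<length xs. snd (xs ! i) \<longrightarrow> (\<forall>j<i. fst (xs ! j) \<noteq> fst (xs ! i)))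
      \<longleftrightarrow> (\<forall>k. ?f k \<in> insert [] (blocks Unrestricted k))" .
  have ob: "(\<forall>k. ?f k \<in> insert [] (blocks Unrestricted k)) \<and> obeys v r xs \<longleftrightarrow>
      (\<forall>k. ?f k \<in> insert [] (blocks Unrestricted k)) \<and> (\<forall>k. has_parity v k \<longrightarrow> ?f k \<in> insert [] (blocks r k))" for v r
    using obeys_Distinct_iff_blocks[of v xs] by (cases r) (simp_all only: obeys.simps(1), blast+)
  have blk: "(\<forall>k. ?f k \<in> insert [] (blocks Unrestricted k)) \<and> obeys x y xs \<and> obeys z w xs \<longleftrightarrow>
      (\<forall>k. ?f k \<in> insert [] (blocks (if has_parity x k then y else w) k))"
  proof -
    have "(\<forall>k. ?f k \<in> insert [] (blocks Unrestricted k)) \<and> obeys x y xs \<and> obeys z w xs \<longleftrightarrow>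
       (\<forall>k. ?f k \<in> insert [] (blocks Unrestricted k)) \<and>
       (\<forall>k. has_parity x k \<longrightarrow> ?f k \<in> insert [] (blocks y k)) \<and>
       (\<forall>k. \<not> has_parity x k \<longrightarrow> ?f k \<in> insert [] (blocks w k))"
      using ob[of x y] ob[of z w] has_parity_other[OF xz] by blast
    also have "\<dots> \<longleftrightarrow> (\<forall>k. ?f k \<in> insert [] (blocks (if has_parity x k then y else w) k))"
    proof -
      have "?f k \<in> insert [] (blocks (if has_parity x k then y else w) k) \<longleftrightarrow>
          ?f k \<in> insert [] (blocks Unrestricted k) \<and>
          (has_parity x k \<longrightarrow> ?f k \<in> insert [] (blocks y k)) \<and>
          (\<not> has_parity x k \<longrightarrow> ?f k \<in> insert [] (blocks w k))" for k
        using blocks_subset_Unrestricted[of y k] blocks_subset_Unrestricted[of w k]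
        by (cases "has_parity x k") (auto simp del: blocks.simps)
      thus ?thesis
        by (simp only: all_conj_distrib)
    qed
    finally show ?thesis .
  qed
  have "?f 0 = [] \<and> (\<forall>k. ?f k \<in> insert [] (blocks (if has_parity x k then y else w) k)) \<longleftrightarrow>
     (\<forall>k. ?f k \<in> (if k = 0 then {[]} else insert [] (blocks (if has_parity x k then y else w) k)))"
    (is "_ \<and> (\<forall>k. ?Q k) \<longleftrightarrow> (\<forall>k. ?P k)")
  proof -
    have "?P k \<longleftrightarrow> (k = 0 \<longrightarrow> ?f 0 = []) \<and> ?Q k" for k
      by (cases "k = 0") (simp_all del: blocks.simps, blast)
    thus ?thesis
      by (simp only: all_conj_distrib) blast
  qed
  with over blk pos sep show ?thesis
    unfolding separated_overpartitions_def is_overpartition_def is_partition_def block_lists_def mem_Collect_eq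
    by blast
qed

text \<open>
  With \<open>m\<close> the largest part of parity \<open>x\<close>, the separation condition says precisely that no part of
  parity \<open>z\<close> is smaller than \<open>m\<close>.
\<close>

lemma separated_overpartitions_pivot:
  assumes xz: "x \<noteq> z"
  shows "(\<Union>n. separated_overpartitions x y z w n) =
     (\<Union>m\<in>insert 0 {m. has_parity x m}. block_lists (pivot_blocks x y z w m))"
proof (intro equalityI subsetI)
  fix xs assume "xs \<in> (\<Union>n. separated_overpartitions x y z w n)"
  hence above: "parity_above z x (map fst xs)"
    and sorted: "sorted_wrt (\<ge>) (map fst xs)"
    and f: "filter (\<lambda>u. fst u = k) xs \<in> (if k = 0 then {[]} else insert [] (blocks (if has_parity x k then y else w) k))" for k
    by (auto simp: separated_overpartitions_iff_blocks[OF xz] block_lists_def simp del: blocks.simps)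
  have pos: "k > 0" if "k \<in> fst ` set xs" for k
    using f[of 0] that by (auto simp: filter_empty_conv intro: Nat.gr0I)
  define M where "M = insert 0 {k \<in> fst ` set xs. has_parity x k}"
  define m where "m = Max M"
  have M: "finite M" "M \<noteq> {}"
    by (auto simp: M_def)
  have m_in: "m \<in> M" and m_max: "\<And>k. k \<in> M \<Longrightarrow> k \<le> m"
    using M by (auto simp: m_def)
  have nonempty: "filter (\<lambda>u. fst u = k) xs = [] \<longleftrightarrow> k \<notin> fst ` set xs" for k
    by (auto simp: filter_empty_conv)
  have "filter (\<lambda>u. fst u = k) xs \<in> pivot_blocks x y z w m k" for k
  proof (cases "k = 0 \<or> k \<notin> fst ` set xs \<and> k \<noteq> m")
    case True
    thus ?thesis
    proof (cases "k = 0")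
      case True
      show ?thesis
        using f[of 0] unfolding True pivot_blocks_def by simp
    next
      case False
      with True have "filter (\<lambda>u. fst u = k) xs = []" "k \<noteq> m"
        unfolding nonempty by blast+
      thus ?thesis
        using Nil_in_pivot_blocks by simp
    qed
  next
    case False
    hence k: "k \<noteq> 0" "k \<in> fst ` set xs"
      using m_in by (auto simp: M_def)
    hence fk: "filter (\<lambda>u. fst u = k) xs \<in> blocks (if has_parity x k then y else w) k"
      using f[of k] nonempty[of k] by auto
    show ?thesis
    proof (cases "has_parity x k")
      case True
      hence "k \<le> m"
        using k by (intro m_max) (auto simp: M_def)
      thus ?thesis
        using fk True k by (auto simp: pivot_blocks_def simp del: blocks.simps)
    next
      case npar: False
      hence zk: "has_parity z k"
        using has_parity_other[OF xz] by simp
      have "k > m"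
      proof (cases "m = 0")
        case False
        hence "m \<in> fst ` set xs" "has_parity x m"
          using m_in by (auto simp: M_def)
        thus ?thesis
          using above zk k(2) unfolding parity_above_def by auto
      qed (use k in simp)
      thus ?thesis
        using fk npar k zk by (auto simp: pivot_blocks_def simp del: blocks.simps)
    qed
  qed
  hence "xs \<in> block_lists (pivot_blocks x y z w m)"
    using sorted by (simp add: block_lists_def)
  moreover have "m \<in> insert 0 {m. has_parity x m}"
    using m_in by (auto simp: M_def)
  ultimately show "xs \<in> (\<Union>m\<in>insert 0 {m. has_parity x m}. block_lists (pivot_blocks x y z w m))"
    by blast
next
  fix xs assume "xs \<in> (\<Union>m\<in>insert 0 {m. has_parity x m}. block_lists (pivot_blocks x y z w m))"
  then obtain m where m: "m = 0 \<or> has_parity x m" and xs: "xs \<in> block_lists (pivot_blocks x y z w m)"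
    by blast
  have f: "filter (\<lambda>u. fst u = k) xs \<in> pivot_blocks x y z w m k" for k
    using xs by (simp add: block_lists_def)
  have "parity_above z x (map fst xs)"
    unfolding parity_above_def
  proof (intro ballI impI)
    fix k l assume k: "k \<in> set (map fst xs)" "has_parity z k" and l: "l \<in> set (map fst xs)" "has_parity x l"
    have "filter (\<lambda>u. fst u = k) xs \<noteq> []" "filter (\<lambda>u. fst u = l) xs \<noteq> []"
      using k l by (auto simp: filter_empty_conv)
    with pivot_separates[OF xz m f] k(2) l(2) have "k > m" "l \<le> m"
      by blast+
    thus "l < k"
      by simp
  qed
  moreover have "pivot_blocks x y z w m k \<subseteq>
      (if k = 0 then {[]} else insert [] (blocks (if has_parity x k then y else w) k))" for k
    using m has_parity_other[OF xz, of k] by (auto simp: pivot_blocks_def simp del: blocks.simps)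
  hence "block_lists (pivot_blocks x y z w m) \<subseteq>
      block_lists (\<lambda>k. if k = 0 then {[]} else insert [] (blocks (if has_parity x k then y else w) k))"
    by (rule block_lists_mono)
  with xs have "xs \<in> block_lists (\<lambda>k. if k = 0 then {[]} else insert [] (blocks (if has_parity x k then y else w) k))"
    by blast
  ultimately show "xs \<in> (\<Union>n. separated_overpartitions x y z w n)"
    unfolding separated_overpartitions_iff_blocks[OF xz] UN_iff by blast
qed

text \<open>
  A larger pivot would be a part of parity \<open>x\<close> exceeding the smaller pivot.
\<close>

lemma pivot_unique:
  assumes xz: "x \<noteq> z"
    and m: "m \<in> insert 0 {m. has_parity x m}" "xs \<in> block_lists (pivot_blocks x y z w m)"
    and m': "m' \<in> insert 0 {m. has_parity x m}" "xs \<in> block_lists (pivot_blocks x y z w m')"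
  shows "m = m'"
proof -
  have False if "m < m'" "has_parity x m'" "xs \<in> block_lists (pivot_blocks x y z w m)"
      "xs \<in> block_lists (pivot_blocks x y z w m')" for m m'
  proof -
    have "filter (\<lambda>u. fst u = m') xs \<in> pivot_blocks x y z w m m'"
      "filter (\<lambda>u. fst u = m') xs \<in> pivot_blocks x y z w m' m'"
      using that by (auto simp: block_lists_def)
    thus False
      using that(1,2) has_parity_other[OF xz, of m'] Nil_notin_blocks by (simp add: pivot_blocks_def)
  qed
  thus ?thesis
    using m m' by (metis (no_types, lifting) insert_iff linorder_neqE_nat mem_Collect_eq not_less_zero)
qed

section \<open>The generating functions as single q-series\<close>

lemma has_sum_disjoint_UN:
  fixes f :: "'a \<Rightarrow> 'c :: {topological_comm_monoid_add, t3_space}"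
  assumes f: "(f has_sum s) (\<Union>i\<in>I. L i)"
    and disj: "\<And>i j x. i \<in> I \<Longrightarrow> j \<in> I \<Longrightarrow> x \<in> L i \<Longrightarrow> x \<in> L j \<Longrightarrow> i = j"
    and g: "\<And>i. i \<in> I \<Longrightarrow> (f has_sum g i) (L i)"
  shows "(g has_sum s) I"
proof (rule has_sum_SigmaD)
  have "bij_betw snd (Sigma I L) (\<Union>i\<in>I. L i)"
    using disj by (auto simp: bij_betw_def inj_on_def image_iff)
  from iffD2[OF has_sum_reindex_bij_betw[OF this] f]
  show "((\<lambda>z. f (snd z)) has_sum s) (Sigma I L)" .
qed (use g in simp)

lemma pivot_blocks_subset: "pivot_blocks x y z w m k \<subseteq> all_blocks k"
  using blocks_subset_Unrestricted[of y k] blocks_subset_Unrestricted[of w k]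
  unfolding pivot_blocks_def all_blocks_def by (simp del: blocks.simps) blast

text \<open>
  The sum over all overpartitions of the family is evaluated in two ways, by weight and by pivot.
\<close>

lemma F_sep_has_sum_pivots:
  fixes q :: complex
  assumes xz: "x \<noteq> z" and q: "norm q < 1"
  shows "((\<lambda>m. infsum (\<lambda>xs. q ^ weight xs) (block_lists (pivot_blocks x y z w m)))
            has_sum F_sep x y z w q) (insert 0 {m. has_parity x m})"
proof -
  let ?V = "separated_overpartitions x y z w"
  define S where "S = (\<Union>n. ?V n)"
  have S_sub: "S \<subseteq> block_lists all_blocks"
    unfolding S_def separated_overpartitions_pivot[OF xz]
    using block_lists_mono[OF pivot_blocks_subset] by (intro UN_least)
  have summable: "(\<lambda>xs. norm (r ^ weight xs)) summable_on S"
    if "norm r < 1" for r :: "'b :: {real_normed_field, banach}"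
    using summable_on_subset[OF summable_all_overpartitions[OF that] S_sub] .
  have V_weight: "weight xs = n" if "xs \<in> ?V n" for xs n
    using that unfolding separated_overpartitions_iff_blocks[OF xz] by blast
  \<comment> \<open>The weight takes the constant value \<open>n\<close> there, so convergence at \<open>1/2\<close> already forces finiteness.\<close>
  have fin: "finite (?V n)" for n
  proof (rule ccontr)
    assume inf: "infinite (?V n)"
    have "(\<lambda>xs. norm ((1/2::real) ^ weight xs)) summable_on ?V n"
      by (rule summable_on_subset[OF summable]) (auto simp: S_def)
    hence "(\<lambda>_. (1/2::real) ^ n) summable_on ?V n"
      by (rule summable_on_cong[THEN iffD1, rotated]) (simp add: V_weight)
    with infsum_diverge_constant[OF inf, of "(1/2::real) ^ n"] show False
      by simp
  qed
  have s: "((\<lambda>xs. q ^ weight xs) has_sum infsum (\<lambda>xs. q ^ weight xs) S) S"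
    by (rule has_sum_infsum, rule abs_summable_summable, rule summable[OF q])
  have "((\<lambda>n. of_nat (p_sep x y z w n) * q ^ n) has_sum infsum (\<lambda>xs. q ^ weight xs) S) UNIV"
  proof (rule has_sum_disjoint_UN)
    show "((\<lambda>xs. q ^ weight xs) has_sum infsum (\<lambda>xs. q ^ weight xs) S) (\<Union>n. ?V n)"
      using s by (simp only: S_def)
    show "((\<lambda>xs. q ^ weight xs) has_sum of_nat (p_sep x y z w n) * q ^ n) (?V n)" for n
    proof -
      have "(\<Sum>xs\<in>?V n. q ^ weight xs) = (\<Sum>xs\<in>?V n. q ^ n)"
        by (intro sum.cong refl) (simp add: V_weight)
      also have "\<dots> = of_nat (p_sep x y z w n) * q ^ n"
        by (simp add: p_sep_def separated_overpartitions_def)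
      finally show ?thesis
        using has_sum_finite[OF fin, of "\<lambda>xs. q ^ weight xs" n] by simp
    qed
  qed (use V_weight in blast)
  hence "(\<lambda>n. of_nat (p_sep x y z w n) * q ^ n) sums infsum (\<lambda>xs. q ^ weight xs) S"
    by (rule has_sum_imp_sums)
  hence F: "F_sep x y z w q = infsum (\<lambda>xs. q ^ weight xs) S"
    unfolding F_sep_def by (rule sums_unique[symmetric])
  show ?thesis
    unfolding F
  proof (rule has_sum_disjoint_UN)
    show "((\<lambda>xs. q ^ weight xs) has_sum infsum (\<lambda>xs. q ^ weight xs) S)
        (\<Union>m\<in>insert 0 {m. has_parity x m}. block_lists (pivot_blocks x y z w m))"
      using s unfolding S_def separated_overpartitions_pivot[OF xz] .
    show "((\<lambda>xs. q ^ weight xs) has_sum infsum (\<lambda>xs. q ^ weight xs) (block_lists (pivot_blocks x y z w m)))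
        (block_lists (pivot_blocks x y z w m))" for m
      by (rule has_sum_infsum, rule abs_summable_summable, rule summable_block_lists[OF q pivot_blocks_subset])
  qed (rule pivot_unique[OF xz])
qed

fun nth_part :: "part_parity \<Rightarrow> nat \<Rightarrow> nat" where
  "nth_part Od j = 2 * j + 1"
| "nth_part Ev j = 2 * j + 2"

definition parts_gf :: "part_parity \<Rightarrow> part_restriction \<Rightarrow> nat \<Rightarrow> complex \<Rightarrow> complex" where
  "parts_gf x r n q = (\<Prod>j<n. 1 + block_gf r (nth_part x j) q)"

lemma nth_part_simps [simp]: "nth_part x j > 0" "has_parity x (nth_part x j)"
  "nth_part x i = nth_part x j \<longleftrightarrow> i = j" "nth_part x i < nth_part x j \<longleftrightarrow> i < j"
  by (cases x; simp)+

lemma range_nth_part: "insert 0 {m. has_parity x m} = insert 0 (range (nth_part x))"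
proof -
  have "m \<in> range (nth_part x)" if "has_parity x m" "m \<noteq> 0" for m
  proof (cases x)
    case Ev
    with that obtain k where "m = 2 * k" "k \<noteq> 0"
      by (auto elim!: evenE)
    hence "m = nth_part x (k - 1)"
      by (cases k) (simp_all add: Ev)
    thus ?thesis by blast
  next
    case Od
    with that obtain k where "m = 2 * k + 1"
      by (auto elim!: oddE)
    thus ?thesis
      by (auto simp: Od image_iff)
  qed
  thus ?thesis
    by auto
qed

lemma one_plus_block_gf_nonzero:
  fixes q :: complex
  assumes "norm q < 1" "k > 0"
  shows "1 + block_gf r k q \<noteq> 0"
proof -
  have n: "norm (q ^ k) < 1"
    using assms by (simp add: norm_power power_less_one_iff)
  hence "q ^ k \<noteq> 1" "q ^ k \<noteq> -1"
    by (metis norm_one less_irrefl, metis norm_minus_cancel norm_one less_irrefl)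
  thus ?thesis
    by (cases r) (auto simp: field_simps eq_neg_iff_add_eq_0)
qed

lemma parts_gf_nonzero: "norm q < 1 \<Longrightarrow> parts_gf x r n q \<noteq> 0"
  unfolding parts_gf_def by (simp add: one_plus_block_gf_nonzero)

lemma prod_upto_double: "(\<Prod>k=1..2*N. W k) = (\<Prod>j<N. W (nth_part Od j)) * (\<Prod>j<N. W (nth_part Ev j))"
  for W :: "nat \<Rightarrow> complex"
  by (induction N) (simp_all add: mult_ac)

lemma prod_upto_double':
  fixes W :: "nat \<Rightarrow> complex"
  assumes "x \<noteq> z"
  shows "(\<Prod>k=1..2*N. W k) = (\<Prod>j<N. W (nth_part x j)) * (\<Prod>j<N. W (nth_part z j))"
  using assms prod_upto_double[of W N] by (cases x; cases z) (simp_all add: mult.commute)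

definition pivot_gf ::
    "part_parity \<Rightarrow> part_restriction \<Rightarrow> part_parity \<Rightarrow> part_restriction \<Rightarrow> nat \<Rightarrow> complex \<Rightarrow> nat \<Rightarrow> complex" where
  "pivot_gf x y z w m q k =
     (if k = m then block_gf y k q
      else if k < m \<and> has_parity x k then 1 + block_gf y k q
      else if k > m \<and> has_parity z k then 1 + block_gf w k q
      else 1)"

lemma pivot_blocks_limit:
  fixes q :: complex
  assumes xz: "x \<noteq> z" and q: "norm q < 1"
  shows "(\<lambda>N. (\<Prod>j<N. pivot_gf x y z w m q (nth_part x j)) * (\<Prod>j<N. pivot_gf x y z w m q (nth_part z j)))
     \<longlonglongrightarrow> infsum (\<lambda>xs. q ^ weight xs) (block_lists (pivot_blocks x y z w m))"
proof -
  have "(\<lambda>N. \<Prod>k=1..N. pivot_gf x y z w m q k) \<longlonglongrightarrow> infsum (\<lambda>xs. q ^ weight xs) (block_lists (pivot_blocks x y z w m))"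
  proof (rule block_lists_product[OF q, where m = m])
    fix k :: nat assume k: "k > 0"
    have "((\<lambda>b. q ^ weight b) has_sum (\<Sum>b\<in>{[]}. q ^ weight b)) {[]}"
      by (rule has_sum_finite) simp
    hence "((\<lambda>b. q ^ weight b) has_sum 1) {[]}"
      by simp
    thus "((\<lambda>b. q ^ weight b) has_sum pivot_gf x y z w m q k) (pivot_blocks x y z w m k)"
      using k has_sum_blocks(1)[OF q k] has_sum_optional_blocks(1)[OF q k]
      by (cases "k = m") (simp_all add: pivot_gf_def pivot_blocks_def del: blocks.simps block_gf.simps)
  qed (use pivot_blocks_subset Nil_in_pivot_blocks in \<open>auto simp: pivot_blocks_def[of _ _ _ _ _ 0]\<close>)
  from filterlim_compose[OF this, of "\<lambda>N. 2 * N" sequentially]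
  have "(\<lambda>N. \<Prod>k=1..2*N. pivot_gf x y z w m q k) \<longlonglongrightarrow> infsum (\<lambda>xs. q ^ weight xs) (block_lists (pivot_blocks x y z w m))"
    using mult_nat_left_at_top[of 2] by simp
  thus ?thesis
    unfolding prod_upto_double'[OF xz] .
qed

text \<open>
  The offset is due to the even numbers starting at \<open>2\<close>: the even number with index \<open>n\<close> is smaller than
  the odd number with index \<open>n + 1\<close>, but larger than the odd one with index \<open>n\<close>.
\<close>

lemma nth_part_less_iff:
  assumes "x \<noteq> z"
  shows "nth_part x n < nth_part z j \<longleftrightarrow> n + (if z = Od then 1 else 0) \<le> j"
  using assms by (cases x; cases z) auto

text \<open>
  The contribution of the pivot with index \<open>n\<close> consists of the mandatory block of that size, the optional
  smaller parts of parity \<open>x\<close>, and the optional larger parts of parity \<open>z\<close>.  The last factor is the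
  full product \<open>P\<close> divided by its part over the sizes below the pivot.  The pivot \<open>0\<close> contributes \<open>P\<close>.
\<close>

lemma F_sep_sums:
  fixes q :: complex
  assumes xz: "x \<noteq> z" and q: "norm q < 1"
    and P: "(\<lambda>n. parts_gf z w n q) \<longlonglongrightarrow> P"
  shows "(\<lambda>n. P * (block_gf y (nth_part x n) q * parts_gf x y n q
              / parts_gf z w (n + (if z = Od then 1 else 0)) q))
           sums (F_sep x y z w q - P)"
proof -
  define d :: nat where "d = (if z = Od then 1 else 0)"
  define g where "g = (\<lambda>m. infsum (\<lambda>xs. q ^ weight xs) (block_lists (pivot_blocks x y z w m)))"
  have lim: "(\<lambda>N. (\<Prod>j<N. pivot_gf x y z w m q (nth_part x j)) * (\<Prod>j<N. pivot_gf x y z w m q (nth_part z j)))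
      \<longlonglongrightarrow> g m" for m
    unfolding g_def by (rule pivot_blocks_limit[OF xz q])
  have not_x: "\<not> has_parity x (nth_part z j)" for j
    using has_parity_other[OF xz] nth_part_simps(2)[of z] by blast
  have not_z: "\<not> has_parity z (nth_part x j)" for j
    using has_parity_other[OF xz] nth_part_simps(2)[of x] by blast
  have neq: "nth_part z j \<noteq> nth_part x n" for n j
    using not_x[of j] nth_part_simps(2)[of x n] by metis
  have g0: "g 0 = P"
  proof (rule LIMSEQ_unique[OF lim])
    show "(\<lambda>N. (\<Prod>j<N. pivot_gf x y z w 0 q (nth_part x j)) * (\<Prod>j<N. pivot_gf x y z w 0 q (nth_part z j)))
        \<longlonglongrightarrow> P"
      using P by (simp add: pivot_gf_def not_z parts_gf_def nth_part_simps(1)[THEN gr_implies_not0]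
          del: nth_part.simps block_gf.simps)
  qed
  have gn: "g (nth_part x n) = P * (block_gf y (nth_part x n) q * parts_gf x y n q / parts_gf z w (n + d) q)" for n
  proof (rule LIMSEQ_unique[OF lim])
    define H where "H = (\<lambda>N. \<Prod>j<N. pivot_gf x y z w (nth_part x n) q (nth_part x j))"
    define K where "K = (\<lambda>N. \<Prod>j<N. pivot_gf x y z w (nth_part x n) q (nth_part z j))"
    have H: "H (Suc n + i) = parts_gf x y n q * block_gf y (nth_part x n) q" for i
    proof (induction i)
      case 0
      have "(\<Prod>j<n. if j = n then block_gf y (nth_part x j) q else if j < n then 1 + block_gf y (nth_part x j) q else 1)
          = parts_gf x y n q"
        unfolding parts_gf_def by (intro prod.cong) auto
      thus ?case
        by (simp add: H_def pivot_gf_def not_z del: nth_part.simps block_gf.simps)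
    qed (simp add: H_def pivot_gf_def not_z del: nth_part.simps block_gf.simps)
    have K: "K (n + d + i) = parts_gf z w (n + d + i) q / parts_gf z w (n + d) q" for i
    proof (induction i)
      case 0
      have "K (n + d) = 1"
        unfolding K_def by (intro prod.neutral) (auto simp: pivot_gf_def neq not_x nth_part_less_iff[OF xz] d_def)
      thus ?case
        using parts_gf_nonzero[OF q] by simp
    next
      case (Suc i)
      have "K (n + d + Suc i) = K (n + d + i) * (1 + block_gf w (nth_part z (n + d + i)) q)"
        by (simp add: K_def pivot_gf_def neq not_x nth_part_less_iff[OF xz] d_def del: nth_part.simps block_gf.simps)
      thus ?case
        unfolding Suc by (simp add: parts_gf_def)
    qed
    have "(\<lambda>N. parts_gf x y n q * block_gf y (nth_part x n) q * (parts_gf z w N q / parts_gf z w (n + d) q))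
        \<longlonglongrightarrow> parts_gf x y n q * block_gf y (nth_part x n) q * (P / parts_gf z w (n + d) q)"
      by (intro tendsto_intros P parts_gf_nonzero q)
    moreover have "\<forall>\<^sub>F N in sequentially. parts_gf x y n q * block_gf y (nth_part x n) q * (parts_gf z w N q / parts_gf z w (n + d) q)
        = H N * K N"
    proof (rule eventually_sequentiallyI[of "Suc n + d"])
      fix N assume N: "Suc n + d \<le> N"
      have "N = Suc n + (N - Suc n)" "N = n + d + (N - (n + d))"
        using N by simp_all
      with H[of "N - Suc n"] K[of "N - (n + d)"]
      show "parts_gf x y n q * block_gf y (nth_part x n) q * (parts_gf z w N q / parts_gf z w (n + d) q) = H N * K N"
        by simp
    qed
    ultimately have "(\<lambda>N. H N * K N) \<longlonglongrightarrow> parts_gf x y n q * block_gf y (nth_part x n) q * (P / parts_gf z w (n + d) q)"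
      by (rule Lim_transform_eventually)
    thus "(\<lambda>N. (\<Prod>j<N. pivot_gf x y z w (nth_part x n) q (nth_part x j)) *
          (\<Prod>j<N. pivot_gf x y z w (nth_part x n) q (nth_part z j))) \<longlonglongrightarrow> P * (block_gf y (nth_part x n) q * parts_gf x y n q / parts_gf z w (n + d) q)"
      by (simp only: H_def K_def mult_ac times_divide_eq_right)
  qed
  have total: "(g has_sum F_sep x y z w q) (insert 0 (range (nth_part x)))"
    using F_sep_has_sum_pivots[OF xz q] unfolding g_def range_nth_part .
  have "(g has_sum g 0) {0}"
    using has_sum_finite[of "{0}" g] by simp
  from has_sum_Diff[OF total this]
  have "(g has_sum F_sep x y z w q - g 0) (insert 0 (range (nth_part x)) - {0})"
    by simp
  moreover have "insert 0 (range (nth_part x)) - {0} = range (nth_part x)"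
    using nth_part_simps(1)[of x] by (metis Diff_insert_absorb imageE less_numeral_extra(3))
  ultimately have "(g has_sum F_sep x y z w q - g 0) (range (nth_part x))"
    by simp
  hence "((\<lambda>n. g (nth_part x n)) has_sum F_sep x y z w q - g 0) UNIV"
    using has_sum_reindex[of "nth_part x" UNIV g "F_sep x y z w q - g 0"] by (simp add: inj_on_def o_def)
  from has_sum_imp_sums[OF this] show ?thesis
    unfolding g0 gn d_def .
qed

section \<open>The four identities\<close>

lemma parts_gf_qpoch:
  "parts_gf Ev Distinct n q = qpoch (- (q\<^sup>2)) (q\<^sup>2) n"
  "parts_gf Od Distinct n q = qpoch (- q) (q\<^sup>2) n"
  "norm q < 1 \<Longrightarrow> parts_gf Ev Unrestricted n q = qpoch (- (q\<^sup>2)) (q\<^sup>2) n / qpoch (q\<^sup>2) (q\<^sup>2) n"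
  "norm q < 1 \<Longrightarrow> parts_gf Od Unrestricted n q = qpoch (- q) (q\<^sup>2) n / qpoch q (q\<^sup>2) n"
proof -
  have pw: "q\<^sup>2 * (q\<^sup>2) ^ j = q ^ nth_part Ev j" "q * (q\<^sup>2) ^ j = q ^ nth_part Od j" for j
    by (simp_all add: power_mult power2_eq_square power_mult_distrib)
  show "parts_gf Ev Distinct n q = qpoch (- (q\<^sup>2)) (q\<^sup>2) n"
    "parts_gf Od Distinct n q = qpoch (- q) (q\<^sup>2) n"
    unfolding parts_gf_def qpoch_def mult_minus_left pw by (simp_all del: nth_part.simps)
  have u: "1 + block_gf Unrestricted (nth_part x j) q = (1 + q ^ nth_part x j) / (1 - q ^ nth_part x j)"
    if "norm q < 1" for x j
  proof -
    have "norm (q ^ nth_part x j) < 1"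
      using that by (simp add: norm_power power_less_one_iff)
    hence "1 - q ^ nth_part x j \<noteq> 0"
      by (metis eq_iff_diff_eq_0 norm_one less_irrefl)
    thus ?thesis
      by (simp add: field_simps)
  qed
  show "parts_gf Ev Unrestricted n q = qpoch (- (q\<^sup>2)) (q\<^sup>2) n / qpoch (q\<^sup>2) (q\<^sup>2) n"
    "parts_gf Od Unrestricted n q = qpoch (- q) (q\<^sup>2) n / qpoch q (q\<^sup>2) n" if "norm q < 1"
    unfolding parts_gf_def qpoch_def mult_minus_left pw u[OF that] prod_dividef
    by (simp_all del: nth_part.simps)
qed

lemma qpoch_minus_1_Suc: "qpoch (-1) p (Suc n) = 2 * qpoch (- p) p n"
  using qpoch_Suc_left[of "-1" p n] by simp

lemma qpoch_inf_minus_1: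
  assumes "norm p < 1"
  shows "qpoch_inf (-1) p = 2 * qpoch_inf (- p) p"
proof (rule LIMSEQ_unique)
  show "(\<lambda>n. qpoch (-1) p (Suc n)) \<longlonglongrightarrow> qpoch_inf (-1) p"
    by (rule LIMSEQ_Suc[OF qpoch_LIMSEQ[OF assms]])
  show "(\<lambda>n. qpoch (-1) p (Suc n)) \<longlonglongrightarrow> 2 * qpoch_inf (- p) p"
    unfolding qpoch_minus_1_Suc by (intro tendsto_intros qpoch_LIMSEQ assms)
qed

lemma square_power_choose_2: "q ^ n * (q\<^sup>2) ^ (n choose 2) = (q :: 'a :: comm_monoid_mult) ^ (n\<^sup>2)"
proof -
  have "n + 2 * (n choose 2) = n\<^sup>2"
    by (induction n) (simp_all add: numeral_2_eq_2 power2_eq_square)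
  thus ?thesis
    by (simp flip: power_mult power_add)
qed

lemma three_term_power:
  "(q * - (q\<^sup>2)) ^ n * (q\<^sup>2) ^ (n choose 2) = (- 1) ^ n * (q :: 'a :: comm_ring_1) ^ (n\<^sup>2 + 2 * n)"
proof -
  have "(q * - (q\<^sup>2)) ^ n * (q\<^sup>2) ^ (n choose 2) = (- 1) ^ n * (q\<^sup>2) ^ n * (q ^ n * (q\<^sup>2) ^ (n choose 2))"
    by (simp only: power_mult_distrib power_minus[of "q\<^sup>2"] mult_ac)
  also have "\<dots> = (- 1) ^ n * q ^ (2 * n) * q ^ (n\<^sup>2)"
    by (simp only: square_power_choose_2 power_mult)
  finally show ?thesis
    by (simp add: power_add mult_ac)
qed

context
  fixes q :: complex
  assumes q: "norm q < 1"
begin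

lemma norm_q2: "norm (q\<^sup>2) < 1"
  using q by (simp add: norm_power power_less_one_iff)

lemma q_factors_neq_1:
  "q * (q\<^sup>2) ^ k \<noteq> 1" "- q * (q\<^sup>2) ^ k \<noteq> 1" "q\<^sup>2 * (q\<^sup>2) ^ k \<noteq> 1" "- (q\<^sup>2) * (q\<^sup>2) ^ k \<noteq> 1"
  by (rule mult_power_neq_1[OF norm_q2], use q norm_q2 in simp)+

lemma q_nonzero:
  "qpoch q (q\<^sup>2) n \<noteq> 0" "qpoch (- q) (q\<^sup>2) n \<noteq> 0" "qpoch (q\<^sup>2) (q\<^sup>2) n \<noteq> 0" "qpoch (- (q\<^sup>2)) (q\<^sup>2) n \<noteq> 0"
  "qpoch_inf q (q\<^sup>2) \<noteq> 0" "qpoch_inf (- q) (q\<^sup>2) \<noteq> 0" "qpoch_inf (q\<^sup>2) (q\<^sup>2) \<noteq> 0" "qpoch_inf (- (q\<^sup>2)) (q\<^sup>2) \<noteq> 0"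
  by (intro qpoch_nonzero qpoch_inf_nonzero norm_q2 q_factors_neq_1)+

lemma parts_gf_LIMSEQ:
  "(\<lambda>n. parts_gf Ev Distinct n q) \<longlonglongrightarrow> qpoch_inf (- (q\<^sup>2)) (q\<^sup>2)"
  "(\<lambda>n. parts_gf Od Distinct n q) \<longlonglongrightarrow> qpoch_inf (- q) (q\<^sup>2)"
  "(\<lambda>n. parts_gf Ev Unrestricted n q) \<longlonglongrightarrow> qpoch_inf (- (q\<^sup>2)) (q\<^sup>2) / qpoch_inf (q\<^sup>2) (q\<^sup>2)"
  "(\<lambda>n. parts_gf Od Unrestricted n q) \<longlonglongrightarrow> qpoch_inf (- q) (q\<^sup>2) / qpoch_inf q (q\<^sup>2)"
  unfolding parts_gf_qpoch parts_gf_qpoch(3,4)[OF q]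
  by (intro tendsto_divide qpoch_LIMSEQ norm_q2 q_nonzero)+

text \<open>
  Since \<open>2 (-p;p)\<^sub>n = (-1;p)\<^sub>n\<^sub>+\<^sub>1\<close>, the summand of pivot \<open>2n + 2\<close> is the term \<open>h (Suc n)\<close> of Heine's
  series, and the contribution of the overpartitions into odd parts only is, up to the common factor \<open>P\<close>, the
  missing term \<open>h 0 = 1\<close>.
\<close>

lemma F_sep_Ev_Unrestricted_Od_Distinct:
  "F_sep Ev Unrestricted Od Distinct q =
     qpoch_inf (- (q\<^sup>2)) (q\<^sup>2) / qpoch_inf (q\<^sup>2) (q\<^sup>2) * mock_phi q"
proof -
  define p where "p = q\<^sup>2"
  define P where "P = qpoch_inf (- q) p"
  define h where "h = (\<lambda>n. qpoch (-1) p n / qpoch p p n * p ^ n / qpoch (- q) p n)"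
  define S where "S = qpoch_inf (-1) p / (2 * qpoch_inf p p * P) * (\<Sum>k. q ^ k * p ^ (k choose 2) / qpoch (- p) p k)"
  note nz = q_nonzero[folded p_def]
  have "h sums S"
    unfolding h_def S_def P_def using heine_transformation_limit[of p q] norm_q2 q by (simp add: p_def)
  hence h_Suc: "(\<lambda>n. P * h (Suc n)) sums (P * (S - 1))"
  proof (intro sums_mult)
    have "h 0 = 1"
      by (simp add: h_def)
    with \<open>h sums S\<close> show "(\<lambda>n. h (Suc n)) sums (S - 1)"
      by (simp add: sums_Suc_iff)
  qed
  have eq: "block_gf Unrestricted (nth_part Ev n) q * parts_gf Ev Unrestricted n q
      / parts_gf Od Distinct (n + (if Od = Od then 1 else 0)) q = h (Suc n)" for n
  proof -
    have "q ^ nth_part Ev n = p ^ Suc n"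
      by (simp add: p_def power_mult power2_eq_square power_mult_distrib)
    thus ?thesis
      unfolding h_def qpoch_minus_1_Suc parts_gf_qpoch parts_gf_qpoch(3)[OF q] block_gf.simps p_def[symmetric]
      by (simp add: qpoch_Suc mult_ac)
  qed
  have "(\<lambda>n. P * h (Suc n)) sums (F_sep Ev Unrestricted Od Distinct q - P)"
    using F_sep_sums[of Ev Od q Distinct P Unrestricted, unfolded eq] q parts_gf_LIMSEQ(2)
    by (simp add: P_def p_def)
  from sums_unique2[OF this h_Suc] have "F_sep Ev Unrestricted Od Distinct q = P * S"
    by (simp add: algebra_simps)
  also have "\<dots> = qpoch_inf (- p) p / qpoch_inf p p * (\<Sum>k. q ^ k * p ^ (k choose 2) / qpoch (- p) p k)"
    using nz(6) qpoch_inf_minus_1[of p] norm_q2 unfolding S_def P_def by (simp add: p_def)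
  finally show ?thesis
    unfolding mock_phi_def p_def square_power_choose_2 .
qed

text \<open>
  The three-term relation at \<open>y = -1\<close>, \<open>D = -p\<close>, \<open>t = q\<close> for \<open>p = q\<^sup>2\<close>.  In the products of the last
  series, \<open>(-1;p)\<^sub>n\<^sub>+\<^sub>1 / (-p;p)\<^sub>n\<^sub>+\<^sub>1\<close> collapses to \<open>2 / (1 + p\<^sup>n\<^sup>+\<^sup>1)\<close>.
\<close>

lemma F_sep_Od_Distinct_Ev_Unrestricted:
  "F_sep Od Distinct Ev Unrestricted q =
     qpoch_inf (- (q\<^sup>2)) (q\<^sup>2) / qpoch_inf (q\<^sup>2) (q\<^sup>2)
     - q * qpoch_inf (- q) (q\<^sup>2) * (\<Sum>n. q ^ n / qpoch (- (q\<^sup>2)) (q\<^sup>2) (n + 1))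
     + 2 * q * (qpoch_inf (- (q\<^sup>2)) (q\<^sup>2) / qpoch_inf (q\<^sup>2) (q\<^sup>2)) *
         (\<Sum>n. (- 1) ^ n * q ^ (n\<^sup>2 + 2 * n) /
               ((1 + q ^ (2 * n + 2)) * qpoch q (q\<^sup>2) (n + 1)))"
proof -
  define p where "p = q\<^sup>2"
  define P where "P = qpoch_inf (- p) p / qpoch_inf p p"
  define f where "f = (\<Sum>n. q ^ n / qpoch (- p) p (n + 1))"
  define u where "u = (\<lambda>n. (- 1) ^ n * q ^ (n\<^sup>2 + 2 * n) / ((1 + q ^ (2 * n + 2)) * qpoch q p (n + 1)))"
  define T where "T = (\<lambda>n. (\<Prod>k<n + 1. p ^ k - (-1)) * (q * - p) ^ n * p ^ (n choose 2)
                / (qpoch (- p) p (n + 1) * qpoch q p (n + 1)))"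
  define L where "L = ((qpoch_inf p p * qpoch_inf (- q) p / qpoch_inf (- p) p) * f - (\<Sum>n. T n)) / (-1)"
  note nz = q_nonzero[folded p_def]
  have p: "norm p < 1"
    unfolding p_def by (rule norm_q2)
  have tt: "summable T" "(\<lambda>n. qpoch p p n * qpoch (- q) p n / qpoch (- p) p n * p ^ n) sums L"
    using qpoch_three_term[of p q "- p" "-1"] p q q_factors_neq_1[folded p_def]
    unfolding T_def L_def f_def by simp_all
  have T: "T n = 2 * u n" for n
  proof -
    have "(\<Prod>k<n + 1. p ^ k - (-1)) = qpoch (-1) p (Suc n)"
      by (simp add: qpoch_def add.commute)
    also have "\<dots> = 2 * qpoch (- p) p n"
      by (rule qpoch_minus_1_Suc)
    finally have prod: "(\<Prod>k<n + 1. p ^ k - (-1)) = 2 * qpoch (- p) p n" .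
    have pw: "(q * - p) ^ n * p ^ (n choose 2) = (- 1) ^ n * q ^ (n\<^sup>2 + 2 * n)"
      unfolding p_def by (rule three_term_power)
    have "1 - - p * p ^ n = 1 + q ^ (2 * n + 2)"
      by (simp add: p_def power_mult power2_eq_square power_mult_distrib mult_ac)
    hence "qpoch (- p) p (n + 1) = qpoch (- p) p n * (1 + q ^ (2 * n + 2))"
      by (simp add: qpoch_Suc del: mult_minus_left)
    thus ?thesis
      unfolding T_def u_def prod mult.assoc[of "_ * _" "_ ^ n"] mult.assoc[of _ "(q * - p) ^ n"] pw
      using nz(4)[of n] by simp
  qed
  have "summable u"
    using tt(1) by (simp add: T[abs_def])
  hence suminf_T: "(\<Sum>n. T n) = 2 * (\<Sum>n. u n)"
    unfolding T by (rule suminf_mult)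
  have eq: "block_gf Distinct (nth_part Od n) q * parts_gf Od Distinct n q
      / parts_gf Ev Unrestricted (n + (if Ev = Od then 1 else 0)) q
     = q * (qpoch p p n * qpoch (- q) p n / qpoch (- p) p n * p ^ n)" for n
    unfolding parts_gf_qpoch parts_gf_qpoch(3)[OF q] block_gf.simps p_def[symmetric]
    by (simp add: p_def mult_ac flip: power_mult)
  have "(\<lambda>n. P * (q * (qpoch p p n * qpoch (- q) p n / qpoch (- p) p n * p ^ n)))
      sums (F_sep Od Distinct Ev Unrestricted q - P)"
    using F_sep_sums[of Od Ev q Unrestricted P Distinct, unfolded eq] q parts_gf_LIMSEQ(3)
    by (simp add: P_def p_def)
  from sums_unique2[OF this sums_mult[OF sums_mult[OF tt(2)]]]
  have "F_sep Od Distinct Ev Unrestricted q = P + P * (q * L)"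
    by (simp add: algebra_simps)
  also have "\<dots> = P - q * qpoch_inf (- q) p * f + 2 * q * P * (\<Sum>n. u n)"
    unfolding L_def suminf_T P_def using nz by (simp add: field_simps)
  finally show ?thesis
    unfolding P_def f_def u_def p_def .
qed

text \<open>
  The three-term relation at \<open>y = -1/q\<close>, \<open>D = -p\<close>, \<open>t = q\<close> for \<open>p = q\<^sup>2\<close>.  The series it transforms starts one index earlier: as
  \<open>(-1;p)\<^sub>n\<^sub>+\<^sub>1 = 2 (-p;p)\<^sub>n\<close>, the sum over the pivots \<open>2n + 2\<close> is half of that series without its constant
  term \<open>1\<close>.  This is the origin of the factor \<open>1/2\<close> and of the summand \<open>1\<close> next to the last series.
\<close>

lemma F_sep_Ev_Distinct_Od_Unrestricted:
  "F_sep Ev Distinct Od Unrestricted q =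
     - q * qpoch_inf (- (q\<^sup>2)) (q\<^sup>2) * (\<Sum>n. q ^ n / qpoch (- (q\<^sup>2)) (q\<^sup>2) (n + 1))
     + 1 / 2 * (qpoch_inf (- q) (q\<^sup>2) / qpoch_inf q (q\<^sup>2)) *
         (1 + (\<Sum>n. (- 1) ^ n * qpoch (- q) (q\<^sup>2) (n + 1) * q ^ (n\<^sup>2 + n) /
               qpochs [- (q\<^sup>2), q] (q\<^sup>2) (n + 1)))"
proof -
  define p where "p = q\<^sup>2"
  define P where "P = qpoch_inf (- q) p / qpoch_inf q p"
  define f where "f = (\<Sum>n. q ^ n / qpoch (- p) p (n + 1))"
  define u where "u = (\<lambda>n. (- 1) ^ n * qpoch (- q) p (n + 1) * q ^ (n\<^sup>2 + n) / qpochs [- p, q] p (n + 1))"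
  note nz = q_nonzero[folded p_def]
  have p: "norm p < 1"
    unfolding p_def by (rule norm_q2)
  define l where "l = (\<lambda>n. qpoch q p n * qpoch (- 1) p n / qpoch (- q) p n * p ^ n)"
  have eq: "block_gf Distinct (nth_part Ev n) q * parts_gf Ev Distinct n q
      / parts_gf Od Unrestricted (n + (if Od = Od then 1 else 0)) q = 1 / 2 * l (Suc n)" for n
  proof -
    have "q ^ nth_part Ev n = p ^ Suc n"
      by (simp add: p_def power_mult power2_eq_square power_mult_distrib)
    thus ?thesis
      unfolding l_def qpoch_minus_1_Suc parts_gf_qpoch parts_gf_qpoch(4)[OF q] block_gf.simps p_def[symmetric]
      by (simp add: mult_ac)
  qed
  have F_sums: "(\<lambda>n. P * (1 / 2 * l (Suc n))) sums (F_sep Ev Distinct Od Unrestricted q - P)"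
    using F_sep_sums[of Ev Od q Unrestricted P Distinct, unfolded eq] q parts_gf_LIMSEQ(4)
    by (simp add: P_def p_def)
  have "F_sep Ev Distinct Od Unrestricted q = - q * qpoch_inf (- p) p * f + 1 / 2 * P * (1 + (\<Sum>n. u n))"
    \<comment> \<open>At \<open>q = 0\<close> there is no \<open>y = -1/q\<close>; there only the empty overpartition contributes.\<close>
  proof (cases "q = 0")
    case True
    have "(\<lambda>n. 0) sums (F_sep Ev Distinct Od Unrestricted q - P)"
      using F_sums by (simp add: l_def p_def True)
    hence "F_sep Ev Distinct Od Unrestricted q = P"
      using sums_unique2[OF _ sums_zero] by fastforce
    moreover have "u n = (if n = 0 then 1 else 0)" for n
      by (simp add: u_def p_def True qpochs_def qpoch_def)
    hence "(\<Sum>n. u n) = 1"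
      using sums_unique[OF sums_single[of 0 "\<lambda>_. 1 :: complex"]] by simp
    ultimately show ?thesis
      by (simp add: True)
  next
    case False
    define T where "T = (\<lambda>n. (\<Prod>k<n + 1. p ^ k - (- 1 / q)) * (q * - p) ^ n * p ^ (n choose 2)
                  / (qpoch (- p) p (n + 1) * qpoch q p (n + 1)))"
    define L where "L = ((qpoch_inf q p * qpoch_inf (- 1) p / qpoch_inf (- q) p) * f - (\<Sum>n. T n)) / (- 1 / q)"
    have args: "- 1 / q * - p = q" "- 1 / q * q = - 1" "- 1 / q * p = - q" "- 1 / q \<noteq> 0"
      using False by (simp_all add: p_def power2_eq_square)
    have tt: "summable T" "l sums L"
      using qpoch_three_term[of p q "- p" "- 1 / q", unfolded args(1-3)] p q q_factors_neq_1[folded p_def] args(4)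
      unfolding T_def L_def f_def l_def by blast+
    have T: "T n = 1 / q * u n" for n
    proof -
      have "p ^ k - (- 1 / q) = (1 - - q * p ^ k) / q" for k
        using False by (simp add: field_simps)
      hence prod: "(\<Prod>k<n + 1. p ^ k - (- 1 / q)) = qpoch (- q) p (n + 1) / q ^ (n + 1)"
        unfolding qpoch_def by (simp only: prod_dividef prod_constant card_lessThan)
      have pw: "(q * - p) ^ n * p ^ (n choose 2) = (- 1) ^ n * q ^ (n\<^sup>2 + n) * q ^ n"
        unfolding p_def three_term_power mult_2 by (simp only: power_add mult_ac)
      have "T n = qpoch (- q) p (n + 1) / q ^ (n + 1) * ((- 1) ^ n * q ^ (n\<^sup>2 + n) * q ^ n)
         / (qpoch (- p) p (n + 1) * qpoch q p (n + 1))"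
        unfolding T_def prod mult.assoc[of _ "(q * - p) ^ n"] pw ..
      also have "\<dots> = 1 / q * u n"
        using False by (simp add: u_def qpochs_def)
      finally show ?thesis .
    qed
    have "summable (\<lambda>n. q * T n)"
      by (rule summable_mult[OF tt(1)])
    hence "summable u"
      using False by (simp add: T)
    hence suminf_T: "(\<Sum>n. T n) = 1 / q * (\<Sum>n. u n)"
      unfolding T by (rule suminf_mult)
    have "(\<lambda>n. l (Suc n)) sums (L - 1)"
    proof -
      have "l 0 = 1"
        by (simp add: l_def)
      with tt(2) show ?thesis
        by (simp add: sums_Suc_iff)
    qed
    from sums_unique2[OF F_sums sums_mult[OF sums_mult[OF this]]]
    have "F_sep Ev Distinct Od Unrestricted q = 1 / 2 * P * (1 + L)"
      by (simp add: field_simps)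
    also have "\<dots> = - q * qpoch_inf (- p) p * f + 1 / 2 * P * (1 + (\<Sum>n. u n))"
      unfolding L_def suminf_T P_def qpoch_inf_minus_1[OF p] using nz False by (simp add: field_simps)
    finally show ?thesis .
  qed
  thus ?thesis
    unfolding P_def f_def u_def p_def .
qed

lemma F_sep_Od_Unrestricted_Ev_Distinct:
  "F_sep Od Unrestricted Ev Distinct q =
     qpoch_inf (- (q\<^sup>2)) (q\<^sup>2) *
       (1 + 2 * q * (\<Sum>n. qpoch (- q) (q\<^sup>2) n /
               (qpoch q (q\<^sup>2) (n + 1) * qpoch (- (q\<^sup>2)) (q\<^sup>2) n) * q ^ (2 * n)))"
proof -
  define p where "p = q\<^sup>2"
  define P where "P = qpoch_inf (- p) p"
  define u where "u = (\<lambda>n. qpoch (- q) p n / (qpoch q p (n + 1) * qpoch (- p) p n) * q ^ (2 * n))"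
  have eq: "block_gf Unrestricted (nth_part Od n) q * parts_gf Od Unrestricted n q
      / parts_gf Ev Distinct (n + (if Ev = Od then 1 else 0)) q = 2 * q * u n" for n
    unfolding parts_gf_qpoch parts_gf_qpoch(4)[OF q] block_gf.simps
    by (simp add: u_def p_def qpoch_Suc mult_ac flip: power_mult)
  have F_sums: "(\<lambda>n. P * (2 * q * u n)) sums (F_sep Od Unrestricted Ev Distinct q - P)"
    using F_sep_sums[of Od Ev q Distinct P Unrestricted, unfolded eq] q parts_gf_LIMSEQ(1)
    by (simp add: P_def p_def)
  have "F_sep Od Unrestricted Ev Distinct q = P * (1 + 2 * q * (\<Sum>n. u n))"
  proof (cases "q = 0")
    case True
    have "(\<lambda>n. 0) sums (F_sep Od Unrestricted Ev Distinct q - P)"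
      using F_sums by (simp add: True)
    thus ?thesis
      using sums_unique2[OF _ sums_zero] True by fastforce
  next
    case False
    have "P * (2 * q) \<noteq> 0"
      using False q_nonzero(8) by (simp add: P_def p_def)
    with F_sums have "u sums ((F_sep Od Unrestricted Ev Distinct q - P) / (P * (2 * q)))"
      by (intro sums_mult_D) (simp_all add: mult.assoc)
    with \<open>P * (2 * q) \<noteq> 0\<close> show ?thesis
      by (simp add: sums_iff field_simps)
  qed
  thus ?thesis
    unfolding P_def u_def p_def .
qed

end

theorem theorem1p2:
  fixes q :: complex
  assumes "norm q < 1"
  shows
    "(F_sep Ev Unrestricted Od Distinct q =
        qpoch_inf (- (q\<^sup>2)) (q\<^sup>2) / qpoch_inf (q\<^sup>2) (q\<^sup>2) * mock_phi q) \<and>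
     (F_sep Od Distinct Ev Unrestricted q =
        qpoch_inf (- (q\<^sup>2)) (q\<^sup>2) / qpoch_inf (q\<^sup>2) (q\<^sup>2)
        - q * qpoch_inf (- q) (q\<^sup>2) * (\<Sum>n. q ^ n / qpoch (- (q\<^sup>2)) (q\<^sup>2) (n + 1))
        + 2 * q * (qpoch_inf (- (q\<^sup>2)) (q\<^sup>2) / qpoch_inf (q\<^sup>2) (q\<^sup>2)) *
            (\<Sum>n. (- 1) ^ n * q ^ (n\<^sup>2 + 2 * n) /
                  ((1 + q ^ (2 * n + 2)) * qpoch q (q\<^sup>2) (n + 1)))) \<and>
     (F_sep Ev Distinct Od Unrestricted q =
        - q * qpoch_inf (- (q\<^sup>2)) (q\<^sup>2) * (\<Sum>n. q ^ n / qpoch (- (q\<^sup>2)) (q\<^sup>2) (n + 1))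
        + 1 / 2 * (qpoch_inf (- q) (q\<^sup>2) / qpoch_inf q (q\<^sup>2)) *
            (1 + (\<Sum>n. (- 1) ^ n * qpoch (- q) (q\<^sup>2) (n + 1) * q ^ (n\<^sup>2 + n) /
                  qpochs [- (q\<^sup>2), q] (q\<^sup>2) (n + 1)))) \<and>
     (F_sep Od Unrestricted Ev Distinct q =
        qpoch_inf (- (q\<^sup>2)) (q\<^sup>2) *
          (1 + 2 * q * (\<Sum>n. qpoch (- q) (q\<^sup>2) n /
                  (qpoch q (q\<^sup>2) (n + 1) * qpoch (- (q\<^sup>2)) (q\<^sup>2) n) * q ^ (2 * n))))"
  by (intro conjI F_sep_Ev_Unrestricted_Od_Distinct F_sep_Od_Distinct_Ev_Unrestricted
      F_sep_Ev_Distinct_Od_Unrestricted F_sep_Od_Unrestricted_Ev_Distinct assms)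

end
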